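(* Let $d\ge 2$ and let $\mathcal F=\{\mathcal T_h\}_{h\to 0}$ be a family of face-to-face partitions of a polytope $\overline\Omega\subset\mathbb R^d$ into $d$-simplices. Then $\mathcal F$ satisfies Jamet's condition if and only if $\mathcal F$ satisfies the generalized maximum angle condition. Consequently, $\mathcal F$ satisfies Jamet's condition if and only if $\mathcal F$ satisfies the $d$-dimensional maximum angle condition.
   Context: A $d$-simplex in $\mathbb R^d$ is $S=\operatorname{conv}\{A_0,\dots,A_d\}$ where the vertices $A_0,\dots,A_d$ do not lie in a common hyperplane. A family $\mathcal F=\{\mathcal T_h\}_{h\to0}$ of face-to-face (conforming) partitions is a family of partitions $\mathcal T_h$ of $\overline\Omega$ into $d$-simplices such that any two simplices of $\mathcal T_h$ intersect in a common face (or not at all); $h$ is the mesh size. $S^{d-1}$ denotes the unit sphere in $\mathbb R^d$. Jamet's condition: for a set $E=\{\vec e_i\}_{i=1}^d$ of unit vectors in $\mathbb R^d$ and $\vec u\in S^{d-1}$, let $\theta_i(\vec u)\in[0,\pi/2]$ be the angle between $\vec u$ and the line through the origin spanned by $\vec e_i$, and put $$\theta=\theta(E)=\max_{\vec u\in S^{d-1}}\ \min_{i=1,\dots,d}\theta_i(\vec u).$$ The family $\mathcal F$ satisfies Jamet's condition if there exists a constant $\theta_0<\pi/2$ such that for all $\mathcal T_h\in\mathcal F$ and all $S\in\mathcal T_h$ one can choose a set $E$ of $d$ unit vectors along edges of $S$ with $\theta(E)\le\theta_0$. Dihedral angles: for a simplex of dimension $k\ge2$ (regarded inside its $k$-dimensional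 affine hull), the dihedral angle $\beta_{ij}\in(0,\pi)$ between two distinct facets $F_i,F_j$ is defined by $\cos\beta_{ij}=-n_i\cdot n_j$, where $n_i,n_j$ are the outward unit normals of $F_i,F_j$ (in the affine hull). $d$-sine: for a $d$-simplex $S=\operatorname{conv}\{A_0,\dots,A_d\}$ with facets $F_j$ opposite to $A_j$, the $d$-sine of the angle $\hat A_i$ at the vertex $A_i$ is $$\sin_d(\hat A_i\mid A_0A_1\dots A_d)=\frac{d^{\,d-1}(\operatorname{meas}_d S)^{d-1}}{(d-1)!\,\prod_{j=0,\,j\ne i}^{d}\operatorname{meas}_{d-1}F_j}.$$ For $d$ linearly independent vectors $\vec v_1,\dots,\vec v_d\in\mathbb R^d$, $\sin_d(\vec v_1,\dots,\vec v_d)$ is the $d$-sine of the angle at the origin of the simplex whose vertices are the origin and the endpoints of the $\vec v_i$ (this value is unchanged when a $\vec v_i$ is multiplied by a nonzero constant, so only the directions matter). For linearly dependent vectors $\sin_d:=0$. Generalized maximum angle condition: there exists a constant $C>0$ such that for every $\mathcal T_h\in\mathcal F$ and every $S\in\mathcal T_h$ one can choose $d$ edges of $S$ which, considered as vectors (translated to start at the origin), satisfy $\sin_d\ge C$. $d$-dimensional maximum angle condition: there exists a constant $\gamma_0<\pi$ such that for every $\mathcal T_h\in\mathcal F$, every $S\in\mathcal T_h$ and every subsimplex $S'\subseteq S$ (of dimension at least $2$, including $S'=S$) whose vertex set is contained in the vertex set of $S$, the maximum dihedral angle of $S'$ is at most $\gamma_0$. *)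

theory Defs
  imports "HOL-Analysis.Analysis"
begin

section \<open>Families of face-to-face partitions\<close>

text \<open>
  A polytope is not assumed to be convex: it is the closure of a bounded domain whose boundary is
  covered by finitely many hyperplanes. (The library constant \<^const>\<open>polytope\<close> means a convex one.)
\<close>

definition polytopal_body :: "'a::euclidean_space set \<Rightarrow> bool" where
  "polytopal_body P \<longleftrightarrow>
     (\<exists>\<Omega>. open \<Omega> \<and> connected \<Omega> \<and> bounded \<Omega> \<and> \<Omega> \<noteq> {} \<and> P = closure \<Omega>) \<and>
     (\<exists>H. finite H \<and> (\<forall>(a, c) \<in> H. a \<noteq> 0) \<and> frontier P \<subseteq> (\<Union>(a, c) \<in> H. {x. a \<bullet> x = c}))"

text \<open>
  \<^const>\<open>triangulation\<close> says that there are finitely many simplices and that any two of them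
  intersect in a common (possibly empty) face.
\<close>

definition face_to_face_partition :: "'a::euclidean_space set \<Rightarrow> 'a set set \<Rightarrow> bool" where
  "face_to_face_partition P T \<longleftrightarrow>
     triangulation T \<and> (\<forall>S\<in>T. int DIM('a) simplex S) \<and> \<Union>T = P"

definition mesh_size :: "'a::euclidean_space set set \<Rightarrow> real" where
  "mesh_size T = Max (diameter ` T)"

text \<open>A family \<open>{T\<^sub>h}\<close> with \<open>h \<rightarrow> 0\<close> is a set of partitions that contains arbitrarily fine ones.\<close>

definition face_to_face_family :: "'a::euclidean_space set \<Rightarrow> 'a set set set \<Rightarrow> bool" where
  "face_to_face_family P \<F> \<longleftrightarrow>
     (\<forall>T\<in>\<F>. face_to_face_partition P T) \<and> (\<forall>\<epsilon>>0. \<exists>T\<in>\<F>. mesh_size T < \<epsilon>)"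

definition vertices :: "'a::euclidean_space set \<Rightarrow> 'a set" where
  "vertices S = {x. x extreme_point_of S}"

text \<open>Each edge contributes both of its orientations.\<close>

definition edge_vectors :: "'a::euclidean_space set \<Rightarrow> 'a set" where
  "edge_vectors S = {b - a | a b. closed_segment a b edge_of S}"

section \<open>Jamet's condition\<close>

text \<open>The angle, in \<open>[0, \<pi>/2]\<close>, between \<open>u\<close> and the line through the origin spanned by \<open>e\<close>.\<close>

definition line_angle :: "'a::euclidean_space \<Rightarrow> 'a \<Rightarrow> real" where
  "line_angle u e = arccos (\<bar>u \<bullet> e\<bar> / (norm u * norm e))"

text \<open>The supremum is a maximum, by continuity and compactness of the sphere.\<close>

definition jamet_angle :: "'a::euclidean_space set \<Rightarrow> real" where
  "jamet_angle E = (SUP u \<in> sphere 0 1. MIN e\<in>E. line_angle u e)"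

definition jamet_condition :: "'a::euclidean_space set set set \<Rightarrow> bool" where
  "jamet_condition \<F> \<longleftrightarrow>
     (\<exists>\<theta>\<^sub>0 < pi/2. \<forall>T\<in>\<F>. \<forall>S\<in>T.
        \<exists>E \<subseteq> sgn ` edge_vectors S. card E = DIM('a) \<and> jamet_angle E \<le> \<theta>\<^sub>0)"

section \<open>The generalized maximum angle condition\<close>

definition direction_space :: "'a::euclidean_space set \<Rightarrow> 'a set" where
  "direction_space S = {x - y | x y. x \<in> affine hull S \<and> y \<in> affine hull S}"

definition orthonormal_basis_of :: "'a::euclidean_space set \<Rightarrow> 'a set \<Rightarrow> bool" where
  "orthonormal_basis_of U B \<longleftrightarrow> pairwise orthogonal B \<and> (\<forall>b\<in>B. norm b = 1) \<and> span B = U"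

text \<open>
  The measure \<open>meas\<^sub>k\<close> of a set with \<open>k\<close>-dimensional affine hull: Lebesgue measure with
  respect to an orthonormal coordinate system of the affine hull (compare \<open>lborel_eq\<close>, which is the
  case of the standard coordinates of the whole space). The choice of the coordinate system does not
  matter, since Lebesgue measure is invariant under isometries.
\<close>

definition flat_measure :: "'a::euclidean_space set \<Rightarrow> 'a measure" where
  "flat_measure S =
     (let a = (SOME a. a \<in> S); B = (SOME B. orthonormal_basis_of (direction_space S) B)
      in distr (\<Pi>\<^sub>M b\<in>B. lborel) borel (\<lambda>f. a + (\<Sum>b\<in>B. f b *\<^sub>R b)))"

definition rel_volume :: "'a::euclidean_space set \<Rightarrow> real" where
  "rel_volume S = measure (flat_measure S) S"

text \<open>
  The \<open>d\<close>-sine of the angle at the vertex \<open>a\<close> of the \<open>d\<close>-simplex with vertex set \<open>V\<close>, where \<open>d\<close> is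
  the dimension of the space. The facet opposite to the vertex \<open>b\<close> is \<open>convex hull (V - {b})\<close>.
\<close>

definition vertex_sine :: "'a::euclidean_space set \<Rightarrow> 'a \<Rightarrow> real" where
  "vertex_sine V a =
     real DIM('a) ^ (DIM('a) - 1) * measure lebesgue (convex hull V) ^ (DIM('a) - 1) /
     (fact (DIM('a) - 1) * (\<Prod>b\<in>V - {a}. rel_volume (convex hull (V - {b}))))"

definition d_sine :: "'a::euclidean_space set \<Rightarrow> real" where
  "d_sine W = (if independent W then vertex_sine (insert 0 W) 0 else 0)"

text \<open>
  A set \<open>W\<close> containing both orientations of an edge is dependent, so its \<open>d\<close>-sine is \<open>0\<close>; hence the
  condition really selects \<open>d\<close> different edges.
\<close>

definition generalized_maximum_angle_condition :: "'a::euclidean_space set set set \<Rightarrow> bool" where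
  "generalized_maximum_angle_condition \<F> \<longleftrightarrow>
     (\<exists>C>0. \<forall>T\<in>\<F>. \<forall>S\<in>T. \<exists>W \<subseteq> edge_vectors S. card W = DIM('a) \<and> d_sine W \<ge> C)"

section \<open>The \<open>d\<close>-dimensional maximum angle condition\<close>

definition outward_unit_normal :: "'a::euclidean_space set \<Rightarrow> 'a set \<Rightarrow> 'a" where
  "outward_unit_normal S F =
     (THE n. norm n = 1 \<and> n \<in> direction_space S \<and>
        (\<forall>x\<in>F. \<forall>y\<in>F. n \<bullet> (x - y) = 0) \<and> (\<forall>x\<in>F. \<forall>y\<in>S. n \<bullet> (y - x) \<le> 0))"

definition dihedral_angle :: "'a::euclidean_space set \<Rightarrow> 'a set \<Rightarrow> 'a set \<Rightarrow> real" where
  "dihedral_angle S F G = arccos (- (outward_unit_normal S F \<bullet> outward_unit_normal S G))"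

definition max_dihedral_angle :: "'a::euclidean_space set \<Rightarrow> real" where
  "max_dihedral_angle S =
     Max {dihedral_angle S F G | F G. F facet_of S \<and> G facet_of S \<and> F \<noteq> G}"

definition maximum_angle_condition :: "'a::euclidean_space set set set \<Rightarrow> bool" where
  "maximum_angle_condition \<F> \<longleftrightarrow>
     (\<exists>\<gamma>\<^sub>0 < pi. \<forall>T\<in>\<F>. \<forall>S\<in>T. \<forall>k\<ge>2. \<forall>S'.
        k simplex S' \<and> S' \<subseteq> S \<and> vertices S' \<subseteq> vertices S \<longrightarrow> max_dihedral_angle S' \<le> \<gamma>\<^sub>0)"

end

theory Submission
  imports Defs
begin

text \<open>
  Call a set of vectors uniformly wide if every direction \<open>u\<close> makes an angle bounded away from
  \<open>\<pi>/2\<close> with one of them. All three conditions are equivalent to the edges of all simplices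
  being uniformly wide. For Jamet's condition, \<open>d\<close> suitable edges are chosen greedily. The
  \<open>d\<close>-sine of independent vectors \<open>w\<^sub>1, \<dots>, w\<^sub>d\<close> is \<open>\<bar>det (n\<^sub>1, \<dots>, n\<^sub>d)\<bar>\<close>, where \<open>n\<^sub>i\<close> is the unit
  normal of the hyperplane spanned by the other vectors, so Cramer's rule bounds widths and
  \<open>d\<close>-sines in terms of each other. For dihedral angles, wideness passes to facets with half
  the constant; and a direction that is nearly orthogonal to all edges of a simplex all of whose
  facets are wide must be close to \<open>\<plusminus>\<close> each facet normal, so that two of the at least three normals
  nearly coincide and the dihedral angle between their facets is close to \<open>\<pi>\<close>.
\<close>

section \<open>Linear images of Lebesgue measure\<close>

text \<open>The \<open>d\<close>-sine involves facet measures taken through an unspecified base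
  point and orthonormal basis. A prism of height 1 over a facet has the same measure in the full
  space, where linear maps scale volume by the determinant; this removes the choices and leaves only
  determinants and heights. Every translation between conditions has to yield a constant depending
  only on \<open>d\<close> and the given bound, never on the shape of the simplex, which may
  degenerate; hence all constants are fixed before the simplex. For dihedral angles the link is
  \<open>norm (n\<^sub>i - n\<^sub>j) ^ 2 = 2 + 2 * cos \<beta>\<close>: an angle near \<pi> means
  nearly equal outward normals, whereas nearly opposite normals mean an angle near 0, which is
  allowed. A thin direction fixes each normal only up to sign, so two normals would not suffice, and
  a third forces two signs to coincide.\<close>

lemma measure_shear_box:
  fixes a b :: "real^'n"
  assumes "m \<noteq> n"
  shows "measure lebesgue ((\<lambda>x. \<chi> i. if i = m then x$m + x$n else x$i) ` cbox a b)
       = measure lebesgue (cbox a b)"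
    (is "measure lebesgue (?h ` _) = _")
proof (cases "cbox a b = {}")
  case False
  \<comment> \<open>\<open>measure_shear_interval\<close> wants a lower corner with nonnegative
    \<open>n\<close>-th coordinate. Translating by \<open>- t\<close> makes that coordinate 0, and
    by linearity the shear turns this translation into another one.\<close>
  define t :: "real^'n" where "t = axis n (a$n)"
  have box: "cbox (a - t) (b - t) = (+) (- t) ` cbox a b"
    using cbox_translation[of "- t" a b] by simp
  have lin: "linear ?h"
    by (rule linearI) (auto simp: vec_eq_iff algebra_simps)
  have "?h ` cbox a b = (+) (?h t) ` ?h ` cbox (a - t) (b - t)"
  proof -
    have "cbox a b = (+) t ` cbox (a - t) (b - t)"
      using cbox_translation[of t "a - t" "b - t"] by simp
    then show ?thesis
      by (auto simp: image_image linear_add[OF lin])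
  qed
  then have "measure lebesgue (?h ` cbox a b) = measure lebesgue (?h ` cbox (a - t) (b - t))"
    by (simp only: measure_translation)
  also have "\<dots> = measure lebesgue (cbox (a - t) (b - t))"
  proof (rule measure_shear_interval[OF assms])
    show "cbox (a - t) (b - t) \<noteq> {}" using False box by simp
    show "0 \<le> (a - t) $ n" by (simp add: t_def)
  qed
  also have "\<dots> = measure lebesgue ((+) (- t) ` cbox a b)"
    by (simp only: box)
  also have "\<dots> = measure lebesgue (cbox a b)"
    by (rule measure_translation)
  finally show ?thesis .
qed simp

lemma det_matrix_shear:
  fixes m n :: "'n::finite"
  assumes "m \<noteq> n"
  shows "det (matrix (\<lambda>x::real^'n. \<chi> i. if i = m then x$m + x$n else x$i)) = 1"
proof -
  have "matrix (\<lambda>x::real^'n. \<chi> i. if i = m then x$m + x$n else x$i)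
      = (\<chi> k. if k = m then row m (mat 1) + 1 *s row n (mat 1) else row k (mat 1))"
    by (auto simp: vec_eq_iff matrix_def row_def mat_def axis_def)
  with det_row_operation[OF assms, of "mat 1 :: real^'n^'n" 1] show ?thesis
    by (simp add: det_I)
qed

text \<open>Measurability of the image is what lets a second map be applied; with linearity included
  as well, the notion is closed under composition and fits induction over elementary linear
  maps.\<close>

definition measure_scales :: "(real^'n \<Rightarrow> real^'n) \<Rightarrow> bool" where
  "measure_scales f \<longleftrightarrow> linear f \<and>
     (\<forall>S\<in>lmeasurable. f ` S \<in> lmeasurable \<and>
        measure lebesgue (f ` S) = \<bar>det (matrix f)\<bar> * measure lebesgue S)"

lemma measure_scales_compose:
  assumes "measure_scales f" "measure_scales g"
  shows "measure_scales (f \<circ> g)"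
  using assms unfolding measure_scales_def image_comp[symmetric]
  by (simp add: linear_compose matrix_compose det_mul abs_mult)

lemma measure_scales_stretch: "measure_scales (\<lambda>x::real^'n. \<chi> i. c i * x $ i)"
proof -
  have "matrix (\<lambda>x::real^'n. \<chi> i. c i * x $ i) = (\<chi> i j. if i = j then c i else 0)"
    by (auto simp: matrix_def axis_def vec_eq_iff)
  moreover have "linear (\<lambda>x::real^'n. \<chi> i. c i * x $ i)"
    by (rule linearI) (auto simp: vec_eq_iff algebra_simps)
  ultimately show ?thesis
    by (auto simp: measure_scales_def measurable_stretch measure_stretch det_diagonal)
qed

lemma measure_scales_shear:
  fixes m n :: "'n::finite"
  assumes "m \<noteq> n"
  shows "measure_scales (\<lambda>x::real^'n. \<chi> i. if i = m then x$m + x$n else x$i)"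
    (is "measure_scales ?h")
proof -
  have lin: "linear (\<lambda>x::real^'n. \<chi> i. if i = m then x$m + x$n else x$i)"
    by (rule linearI) (auto simp: vec_eq_iff algebra_simps)
  have "?h ` S \<in> lmeasurable \<and> measure lebesgue (?h ` S) = 1 * measure lebesgue S"
    if "S \<in> lmeasurable" for S
    using measure_linear_sufficient[OF lin that, of 1] measure_shear_box[OF assms] by simp
  then show ?thesis
    unfolding measure_scales_def det_matrix_shear[OF assms] using lin by simp
qed

lemma measure_scales_swap:
  fixes m n :: "'n::finite"
  assumes "m \<noteq> n"
  shows "measure_scales (\<lambda>x::real^'n. \<chi> i. x $ Transposition.transpose m n i)"
proof -
  define h where "h p q = (\<lambda>x::real^'n. \<chi> i. if i = p then x$p + x$q else x$i)" for p q
  define D where "D = (\<lambda>x::real^'n. \<chi> i. (if i = n then -1 else 1) * x$i)"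
  have "measure_scales (h m n)" "measure_scales (h n m)" "measure_scales D"
    using assms unfolding h_def D_def by (auto intro: measure_scales_shear measure_scales_stretch)
  \<comment> \<open>In the coordinates \<open>(m, n)\<close>, applying the factors from the right:
    (a, b), (a+b, b), (a+b, -b), (a+b, a), (a+b, -a), (b, -a), (b, a).\<close>
  then have "measure_scales (D \<circ> h m n \<circ> D \<circ> h n m \<circ> D \<circ> h m n)"
    by (auto intro!: measure_scales_compose)
  also have "D \<circ> h m n \<circ> D \<circ> h n m \<circ> D \<circ> h m n = (\<lambda>x. \<chi> i. x $ Transposition.transpose m n i)"
    using assms by (auto simp: D_def h_def fun_eq_iff vec_eq_iff Transposition.transpose_def)
  finally show ?thesis .
qed

lemma linear_imp_measure_scales:
  fixes f :: "real^'n \<Rightarrow> real^'n"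
  assumes "linear f"
  shows "measure_scales f"
proof (rule induct_linear_elementary[OF assms, where P = measure_scales])
  fix f :: "real^'n \<Rightarrow> real^'n" and i
  assume "linear f" "\<And>x. f x $ i = 0"
  \<comment> \<open>A zero component makes \<open>f\<close> singular: its determinant is 0 and its
    images are negligible, so both sides of the formula vanish.\<close>
  then have "\<not> surj f"
    by (metis one_neq_zero surjD one_index)
  with \<open>linear f\<close> have "\<not> inj f"
    using linear_injective_imp_surjective by blast
  with \<open>linear f\<close> have "det (matrix f) = 0" "negligible (f ` S)" for S
    using det_nz_iff_inj by (blast, simp add: negligible_linear_singular_image)
  then show "measure_scales f"
    using \<open>linear f\<close> by (simp add: measure_scales_def negligible_imp_measurable negligible_imp_measure0)
qed (simp_all add: measure_scales_compose measure_scales_stretch measure_scales_shear measure_scales_swap)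

text \<open>Unlike \<open>measure_linear_image\<close>, this does not need a well-order on the index type.\<close>

lemma measure_linear_image_cart:
  fixes f :: "real^'n \<Rightarrow> real^'n"
  assumes "linear f" "S \<in> lmeasurable"
  shows "measure lebesgue (f ` S) = \<bar>det (matrix f)\<bar> * measure lebesgue S"
  using linear_imp_measure_scales[OF assms(1)] assms(2) by (auto simp: measure_scales_def)

section \<open>Direction spaces of affine hulls\<close>

lemma direction_space_eq_span:
  fixes S :: "'a::euclidean_space set"
  assumes "a \<in> S"
  shows "direction_space S = span ((\<lambda>x. x - a) ` S)"
proof (intro equalityI subsetI)
  have D: "(\<lambda>x. x - a) ` (affine hull S) = span ((\<lambda>x. x - a) ` S)"
    by (rule diffs_affine_hull_span[OF assms])
  fix u
  { assume "u \<in> direction_space S"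
    then obtain x y where "u = x - y" "x \<in> affine hull S" "y \<in> affine hull S"
      by (auto simp: direction_space_def)
    then have "u = (x - a) - (y - a)" "x - a \<in> span ((\<lambda>x. x - a) ` S)" "y - a \<in> span ((\<lambda>x. x - a) ` S)"
      unfolding D[symmetric] by auto
    then show "u \<in> span ((\<lambda>x. x - a) ` S)"
      using span_diff by blast }
  { assume "u \<in> span ((\<lambda>x. x - a) ` S)"
    then obtain x where "x \<in> affine hull S" "u = x - a"
      unfolding D[symmetric] by blast
    moreover have "a \<in> affine hull S" using assms by (rule hull_inc)
    ultimately show "u \<in> direction_space S"
      by (auto simp: direction_space_def) }
qed

lemma direction_space_convex_hull: "direction_space (convex hull S) = direction_space S"
  by (simp add: direction_space_def affine_hull_convex_hull)

lemma subspace_direction_space: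
  fixes S :: "'a::euclidean_space set"
  assumes "S \<noteq> {}"
  shows "subspace (direction_space S)"
  using assms direction_space_eq_span by (metis equals0I subspace_span)

section \<open>Volumes of simplices and their facets, and the \<open>d\<close>-sine\<close>

text \<open>The linear map taking the \<open>i\<close>-th axis vector to \<open>w i\<close>.
  Simplices and prisms spanned by the \<open>w i\<close> are its images of standard ones, so their
  volumes come from the determinant.\<close>

definition row_comb :: "('n::finite \<Rightarrow> real^'n) \<Rightarrow> real^'n \<Rightarrow> real^'n" where
  "row_comb w x = (\<Sum>i\<in>UNIV. x $ i *\<^sub>R w i)"

lemma linear_row_comb: "linear (row_comb w)"
  unfolding row_comb_def
  by (intro linear_compose_sum ballI linearI) (auto simp: algebra_simps)

lemma row_comb_axis: "row_comb w (axis i 1) = w i"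
  by (simp add: row_comb_def axis_def if_distrib[of "\<lambda>c. c *\<^sub>R _"] cong: if_cong)

lemma det_matrix_row_comb: "det (matrix (row_comb w)) = det (\<chi> i. w i)"
proof -
  have "matrix (row_comb w) = transpose (\<chi> i. w i)"
    by (simp add: vec_eq_iff matrix_def row_comb_axis transpose_def)
  then show ?thesis
    by (simp add: det_transpose)
qed

lemma measure_row_comb_image:
  assumes "S \<in> lmeasurable"
  shows "measure lebesgue (row_comb w ` S) = \<bar>det (\<chi> i. w i)\<bar> * measure lebesgue S"
  using measure_linear_image_cart[OF linear_row_comb assms] by (simp add: det_matrix_row_comb)

lemma measure_simplex_origin:
  fixes w :: "'n::finite \<Rightarrow> real^'n"
  shows "measure lebesgue (convex hull (insert 0 (range w))) = \<bar>det (\<chi> i. w i)\<bar> / fact CARD('n)"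
proof -
  let ?D = "convex hull (insert 0 Basis) :: (real^'n) set"
  have cD: "compact ?D"
    by (simp add: finite_imp_compact_convex_hull)
  have "row_comb w ` insert 0 Basis = insert 0 (range w)"
    using row_comb_axis[of w] linear_0[OF linear_row_comb[of w]]
    by (auto simp: Basis_vec_def image_iff)
  then have "convex hull (insert 0 (range w)) = row_comb w ` ?D"
    by (metis convex_hull_linear_image linear_row_comb)
  moreover have "measure lebesgue ?D = 1 / fact CARD('n)"
    using content_std_simplex[where 'a = "real^'n"] cD
    by (simp add: measure_completion compact_imp_closed borel_closed)
  ultimately show ?thesis
    using measure_row_comb_image[OF lmeasurable_compact[OF cD], of w] by simp
qed

text \<open>Fubini in the coordinate \<open>k\<close>: the factor \<open>{0..1}\<close> has length
  1, so the volume of the cylinder is the product measure of its base. This is how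
  \<open>(d-1)\<close>-dimensional measures become Lebesgue measures of the whole space.\<close>

lemma emeasure_unit_cylinder:
  fixes k :: "'a::euclidean_space"
  assumes k: "k \<in> Basis" and M: "M \<in> sets (\<Pi>\<^sub>M j\<in>Basis-{k}. lborel)"
  defines "C \<equiv> {x. x \<bullet> k \<in> {0..1} \<and> (\<lambda>j\<in>Basis-{k}. x \<bullet> j) \<in> M}"
  shows "C \<in> sets borel"
    and "emeasure lborel C = emeasure (\<Pi>\<^sub>M j\<in>Basis-{k}. lborel) M"
proof -
  interpret product_sigma_finite "\<lambda>_. lborel :: real measure"
    by standard
  let ?A = "Basis - {k}"
  let ?P = "\<Pi>\<^sub>M j\<in>Basis. lborel :: real measure"
  let ?C = "{f \<in> space ?P. f k \<in> {0..1} \<and> restrict f ?A \<in> M}"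
  have ins: "insert k ?A = Basis" using k by auto
  have [measurable]: "M \<in> sets (\<Pi>\<^sub>M j\<in>?A. borel)"
    using M by (simp cong: sets_PiM_cong)
  have "(\<lambda>x. \<lambda>j\<in>?A. x \<bullet> j) \<in> borel \<rightarrow>\<^sub>M (\<Pi>\<^sub>M j\<in>?A. borel)"
    by measurable
  then show C: "C \<in> sets borel"
    unfolding C_def by measurable
  have C': "?C \<in> sets ?P"
  proof -
    have "(\<lambda>f. restrict f ?A) \<in> ?P \<rightarrow>\<^sub>M (\<Pi>\<^sub>M j\<in>?A. lborel)"
      by (rule measurable_restrict_subset) auto
    moreover have "(\<lambda>f. f k) \<in> ?P \<rightarrow>\<^sub>M borel"
      using measurable_component_singleton[OF k, of "\<lambda>_. lborel :: real measure"] by simp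
    ultimately show ?thesis
      using M by measurable
  qed
  have "emeasure lborel C = emeasure ?P ?C"
    using C by (subst lborel_eq, subst emeasure_distr)
      (auto intro!: arg_cong2[where f = emeasure] simp: C_def k restrict_def cong: if_cong)
  also have "\<dots> = (\<integral>\<^sup>+f. indicator ?C f \<partial>Pi\<^sub>M (insert k ?A) (\<lambda>_. lborel))"
    using nn_integral_indicator[OF C'] by (simp only: ins)
  also have "\<dots> = (\<integral>\<^sup>+y. \<integral>\<^sup>+f. indicator ?C (f(k := y)) \<partial>Pi\<^sub>M ?A (\<lambda>_. lborel) \<partial>lborel)"
    using C' by (intro product_nn_integral_insert_rev borel_measurable_indicator) (simp_all only: ins, auto)
  also have "\<dots> = (\<integral>\<^sup>+y. \<integral>\<^sup>+f. indicator {0..1::real} y * indicator M f \<partial>Pi\<^sub>M ?A (\<lambda>_. lborel) \<partial>lborel)"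
  proof (intro nn_integral_cong)
    fix y :: real and f :: "'a \<Rightarrow> real" assume f: "f \<in> space (Pi\<^sub>M ?A (\<lambda>_. lborel))"
    then have "restrict (f(k := y)) ?A = f"
      by (auto simp: space_PiM PiE_def extensional_def fun_eq_iff)
    moreover have "f(k := y) \<in> space ?P"
      using f k by (auto simp: space_PiM PiE_def extensional_def)
    ultimately show "(indicator ?C (f(k := y)) :: ennreal) = indicator {0..1} y * indicator M f"
      by (auto simp: indicator_def)
  qed
  also have "\<dots> = emeasure (Pi\<^sub>M ?A (\<lambda>_. lborel)) M"
    using M by (simp add: nn_integral_cmult nn_integral_multc)
  finally show "emeasure lborel C = emeasure (Pi\<^sub>M ?A (\<lambda>_. lborel)) M" .
qed

text \<open>\<open>flat_measure\<close> indexes coordinates by the vectors of its own basis, the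
  cylinder formula by standard basis vectors; this relabels one into the other.\<close>

lemma distr_PiM_lborel_reindex:
  assumes "finite A" "bij_betw \<psi> A B"
  shows "distr (\<Pi>\<^sub>M b\<in>B. lborel) (\<Pi>\<^sub>M j\<in>A. lborel) (\<lambda>f. \<lambda>j\<in>A. f (\<psi> j)) = (\<Pi>\<^sub>M j\<in>A. lborel :: real measure)"
proof -
  interpret product_sigma_finite "\<lambda>_. lborel :: real measure"
    by standard
  have B: "finite B" "\<psi> ` A = B"
    using assms by (auto simp: bij_betw_def)
  have m: "(\<lambda>f. \<lambda>j\<in>A. f (\<psi> j)) \<in> (\<Pi>\<^sub>M b\<in>B. lborel :: real measure) \<rightarrow>\<^sub>M (\<Pi>\<^sub>M j\<in>A. lborel)"
    using B(2) by (intro measurable_restrict measurable_component_singleton) auto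
  show ?thesis
  proof (rule PiM_eqI)
    fix X :: "_ \<Rightarrow> real set"
    assume X: "\<And>i. i \<in> A \<Longrightarrow> X i \<in> sets lborel"
    let ?\<phi> = "the_inv_into A \<psi>"
    have \<phi>: "?\<phi> (\<psi> i) = i" if "i \<in> A" for i
      using assms that by (simp add: bij_betw_def the_inv_into_f_f)
    have "emeasure (distr (\<Pi>\<^sub>M b\<in>B. lborel) (\<Pi>\<^sub>M j\<in>A. lborel) (\<lambda>f. \<lambda>j\<in>A. f (\<psi> j))) (Pi\<^sub>E A X)
        = emeasure (\<Pi>\<^sub>M b\<in>B. lborel) (\<Pi>\<^sub>E b\<in>B. X (?\<phi> b))"
      using m assms(1) X
      by (subst emeasure_distr)
         (auto intro!: arg_cong2[where f = emeasure] sets_PiM_I_finite simp: space_PiM B(2)[symmetric] \<phi> PiE_iff)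
    also have "\<dots> = (\<Prod>b\<in>B. emeasure lborel (X (?\<phi> b)))"
      using B X \<phi> by (intro emeasure_PiM) auto
    also have "\<dots> = (\<Prod>i\<in>A. emeasure lborel (X i))"
      using prod.reindex_bij_betw[OF assms(2), of "\<lambda>b. emeasure lborel (X (?\<phi> b))"] \<phi> by simp
    finally show "emeasure (distr (\<Pi>\<^sub>M b\<in>B. lborel) (\<Pi>\<^sub>M j\<in>A. lborel) (\<lambda>f. \<lambda>j\<in>A. f (\<psi> j))) (Pi\<^sub>E A X)
        = (\<Prod>i\<in>A. emeasure lborel (X i))" .
  qed (use assms in simp_all)
qed

section \<open>Facet measures as volumes of prisms of height 1\<close>

lemma orthonormal_basis_of_finite:
  assumes "orthonormal_basis_of U B"
  shows "finite B" "card B = dim U"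
proof -
  have "0 \<notin> B"
    using assms by (force simp: orthonormal_basis_of_def)
  then have "independent B"
    using assms pairwise_orthogonal_independent by (auto simp: orthonormal_basis_of_def)
  then show "finite B" "card B = dim U"
    using assms dim_span_eq_card_independent[of B] independent_imp_finite
    by (auto simp: orthonormal_basis_of_def)
qed

lemma orthonormal_basis_of_exists:
  fixes U :: "'a::euclidean_space set"
  assumes "subspace U"
  shows "\<exists>B. orthonormal_basis_of U B"
  using orthonormal_basis_subspace[OF assms] unfolding orthonormal_basis_of_def by metis

lemma orthogonal_transformation_orthonormal_family:
  fixes \<psi> :: "'a::euclidean_space \<Rightarrow> 'a"
  assumes "\<And>i j. i \<in> Basis \<Longrightarrow> j \<in> Basis \<Longrightarrow> \<psi> i \<bullet> \<psi> j = (if i = j then 1 else 0)"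
  shows "orthogonal_transformation (\<lambda>x. \<Sum>j\<in>Basis. (x \<bullet> j) *\<^sub>R \<psi> j)"
  unfolding orthogonal_transformation_def
proof (intro conjI allI)
  show "linear (\<lambda>x. \<Sum>j\<in>Basis. (x \<bullet> j) *\<^sub>R \<psi> j)"
    by (intro linear_compose_sum ballI linearI) (auto simp: algebra_simps inner_add_left)
  show "(\<Sum>j\<in>Basis. (v \<bullet> j) *\<^sub>R \<psi> j) \<bullet> (\<Sum>j\<in>Basis. (w \<bullet> j) *\<^sub>R \<psi> j) = v \<bullet> w" for v w
  proof -
    have "(\<Sum>i\<in>Basis. (v \<bullet> i) * (\<psi> i \<bullet> \<psi> j)) = v \<bullet> j" if "j \<in> Basis" for j
    proof -
      have "(\<Sum>i\<in>Basis. (v \<bullet> i) * (\<psi> i \<bullet> \<psi> j)) = (\<Sum>i\<in>Basis. if i = j then v \<bullet> i else 0)"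
        using assms that by (intro sum.cong) auto
      then show ?thesis using that by simp
    qed
    then show ?thesis
      by (subst euclidean_inner[of v w]) (simp add: inner_sum_left inner_sum_right mult.commute)
  qed
qed

text \<open>The orthogonal map taking \<open>k\<close> to \<open>n\<close> and the remaining axes to
  the basis \<open>B\<close> chosen inside \<open>flat_measure\<close> carries a unit cylinder onto
  the prism, up to translation by the chosen point \<open>a\<close>. Isometries preserve Lebesgue
  measure, so neither choice is visible in the result.\<close>

lemma rel_volume_eq_measure_prism:
  fixes F :: "(real^'n) set"
  assumes F: "compact F" "F \<noteq> {}"
    and dim: "Suc (dim (direction_space F)) = CARD('n)"
    and n: "norm n = 1" "\<And>u. u \<in> direction_space F \<Longrightarrow> n \<bullet> u = 0"
  shows "rel_volume F = measure lebesgue {x + t *\<^sub>R n | x t. x \<in> F \<and> t \<in> {0..1}}"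
    (is "_ = measure lebesgue ?Q")
proof -
  define a where "a = (SOME a. a \<in> F)"
  define B where "B = (SOME B. orthonormal_basis_of (direction_space F) B)"
  have aF: "a \<in> F"
    unfolding a_def using F(2) by (simp add: some_in_eq)
  have B: "orthonormal_basis_of (direction_space F) B"
    unfolding B_def using orthonormal_basis_of_exists[OF subspace_direction_space[OF F(2)]] by (rule someI_ex)
  then have fB: "finite B" and cB: "Suc (card B) = CARD('n)"
    using orthonormal_basis_of_finite[OF B] dim by auto
  have orthB: "b \<bullet> b' = (if b = b' then 1 else 0)" if "b \<in> B" "b' \<in> B" for b b'
    using B that by (auto simp: orthonormal_basis_of_def pairwise_def orthogonal_def norm_eq_1)
  have spB: "span B = direction_space F"
    using B by (simp add: orthonormal_basis_of_def)
  have nB: "n \<bullet> b = 0" if "b \<in> B" for b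
    using n(2) spB that span_base by metis
  obtain k :: "real^'n" where k: "k \<in> Basis"
    using nonempty_Basis by blast
  define A where "A = Basis - {k}"
  have fA: "finite A" and BasisA: "Basis = insert k A" "k \<notin> A"
    using k by (auto simp: A_def)
  then have "card A = card B"
    using cB by (metis DIM_cart DIM_real card_insert_disjoint diff_Suc_1 mult.right_neutral)
  then obtain \<psi> where \<psi>: "bij_betw \<psi> A B"
    using fA fB finite_same_card_bij by blast
  then have \<psi>B: "\<psi> j \<in> B" if "j \<in> A" for j
    using that by (auto simp: bij_betw_def)
  define \<Phi> where "\<Phi> x = (\<Sum>j\<in>Basis. (x \<bullet> j) *\<^sub>R (if j = k then n else \<psi> j))" for x
  have orth: "orthogonal_transformation \<Phi>"
    unfolding \<Phi>_def[abs_def]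
  proof (rule orthogonal_transformation_orthonormal_family)
    fix i j :: "real^'n" assume ij: "i \<in> Basis" "j \<in> Basis"
    have nn: "n \<bullet> n = 1"
      using n(1) by (simp add: norm_eq_1)
    have n\<psi>: "n \<bullet> \<psi> l = 0" "\<psi> l \<bullet> n = 0" if "l \<in> A" for l
      using nB[OF \<psi>B[OF that]] by (simp_all add: inner_commute)
    have \<psi>\<psi>: "\<psi> i \<bullet> \<psi> j = (if i = j then 1 else 0)" if "i \<in> A" "j \<in> A"
      using orthB[OF \<psi>B[OF that(1)] \<psi>B[OF that(2)]] \<psi> that by (auto simp: bij_betw_def inj_on_def)
    consider "i = k" "j = k" | "i = k" "j \<in> A" | "i \<in> A" "j = k" | "i \<in> A" "j \<in> A"
      using ij BasisA(1) by blast
    then show "(if i = k then n else \<psi> i) \<bullet> (if j = k then n else \<psi> j) = (if i = j then 1 else 0)"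
      by cases (use nn n\<psi> \<psi>\<psi> BasisA(2) in auto)
  qed
  have \<Phi>_eq: "\<Phi> x = (\<Sum>j\<in>A. (x \<bullet> j) *\<^sub>R \<psi> j) + (x \<bullet> k) *\<^sub>R n" for x
  proof -
    have "(\<Sum>j\<in>A. (x \<bullet> j) *\<^sub>R (if j = k then n else \<psi> j)) = (\<Sum>j\<in>A. (x \<bullet> j) *\<^sub>R \<psi> j)"
      using BasisA(2) by (intro sum.cong) auto
    then show ?thesis
      unfolding \<Phi>_def BasisA(1) sum.insert[OF fA BasisA(2)] by (simp add: add.commute)
  qed
  let ?PA = "\<Pi>\<^sub>M j\<in>A. lborel :: real measure" and ?PB = "\<Pi>\<^sub>M b\<in>B. lborel :: real measure"
  define g where "g f = a + (\<Sum>b\<in>B. f b *\<^sub>R b)" for f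
  define N where "N = {f \<in> space ?PA. a + (\<Sum>j\<in>A. f j *\<^sub>R \<psi> j) \<in> F}"
  have Fb: "F \<in> sets borel"
    using F(1) by (simp add: borel_closed compact_imp_closed)
  have g: "g \<in> ?PB \<rightarrow>\<^sub>M borel"
    unfolding g_def by measurable
  have N: "N \<in> sets ?PA"
  proof -
    have "(\<lambda>f. a + (\<Sum>j\<in>A. f j *\<^sub>R \<psi> j)) \<in> ?PA \<rightarrow>\<^sub>M borel"
      by measurable
    from measurable_sets[OF this Fb] show ?thesis
      by (simp add: N_def vimage_def Int_def conj_commute)
  qed
  have r: "(\<lambda>f. \<lambda>j\<in>A. f (\<psi> j)) \<in> ?PB \<rightarrow>\<^sub>M ?PA"
    using \<psi>B by (intro measurable_restrict measurable_component_singleton) auto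
  have "emeasure ?PA N = emeasure (distr ?PB ?PA (\<lambda>f. \<lambda>j\<in>A. f (\<psi> j))) N"
    by (simp add: distr_PiM_lborel_reindex[OF fA \<psi>])
  also have "\<dots> = emeasure ?PB ((\<lambda>f. \<lambda>j\<in>A. f (\<psi> j)) -` N \<inter> space ?PB)"
    by (rule emeasure_distr[OF r N])
  also have "(\<lambda>f. \<lambda>j\<in>A. f (\<psi> j)) -` N \<inter> space ?PB = g -` F \<inter> space ?PB"
  proof -
    have "(\<Sum>j\<in>A. f (\<psi> j) *\<^sub>R \<psi> j) = (\<Sum>b\<in>B. f b *\<^sub>R b)" for f
      using sum.reindex_bij_betw[OF \<psi>, of "\<lambda>b. f b *\<^sub>R b"] by simp
    then show ?thesis
      using measurable_space[OF r] by (auto simp: N_def g_def)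
  qed
  also have "emeasure ?PB \<dots> = emeasure (flat_measure F) F"
    using emeasure_distr[OF g Fb] unfolding flat_measure_def Let_def a_def[symmetric] B_def[symmetric]
    by (simp add: g_def[abs_def])
  finally have rv: "rel_volume F = measure ?PA N"
    by (simp add: rel_volume_def measure_def)
  define C where "C = {x. x \<bullet> k \<in> {0..1} \<and> (\<lambda>j\<in>A. x \<bullet> j) \<in> N}"
  have C: "C \<in> sets borel" "emeasure lborel C = emeasure ?PA N"
    using emeasure_unit_cylinder[OF k, of N] N by (simp_all add: C_def A_def)
  have C_iff: "x \<in> C \<longleftrightarrow> x \<bullet> k \<in> {0..1} \<and> a + (\<Sum>j\<in>A. (x \<bullet> j) *\<^sub>R \<psi> j) \<in> F" for x
    by (simp add: C_def N_def space_PiM)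
  have Q: "?Q = (+) a ` \<Phi> ` C"
  proof (intro equalityI subsetI)
    fix y assume "y \<in> ?Q"
    then obtain x t where xt: "y = x + t *\<^sub>R n" "x \<in> F" "t \<in> {0..1}" by blast
    have "x - a \<in> span B"
      unfolding spB direction_space_eq_span[OF aF] using xt(2) by (intro span_base imageI)
    then obtain c where c: "x - a = (\<Sum>b\<in>B. c b *\<^sub>R b)"
      using fB by (auto simp: span_finite)
    \<comment> \<open>The coordinates of \<open>x - a\<close> in \<open>B\<close>, relabelled as
      standard coordinates, with the height \<open>t\<close> placed along \<open>k\<close>.\<close>
    define z where "z = (\<Sum>j\<in>A. c (\<psi> j) *\<^sub>R j) + t *\<^sub>R k"
    have A_inner: "i \<bullet> j = (if i = j then 1 else 0)" "j \<bullet> k = 0" "k \<bullet> j = 0" if "i \<in> A" "j \<in> A" for i j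
      using that k by (auto simp: A_def inner_Basis)
    have zk: "z \<bullet> k = t"
    proof -
      have "(\<Sum>j\<in>A. c (\<psi> j) * (j \<bullet> k)) = 0"
        using A_inner by (intro sum.neutral) auto
      then show ?thesis
        using k by (simp add: z_def inner_add_left inner_sum_left)
    qed
    have zj: "z \<bullet> j = c (\<psi> j)" if "j \<in> A" for j
    proof -
      have "(\<Sum>i\<in>A. c (\<psi> i) * (i \<bullet> j)) = (\<Sum>i\<in>A. if i = j then c (\<psi> i) else 0)"
        using A_inner that by (intro sum.cong) auto
      then show ?thesis
        using that fA A_inner by (simp add: z_def inner_add_left inner_sum_left)
    qed
    have "(\<Sum>j\<in>A. (z \<bullet> j) *\<^sub>R \<psi> j) = (\<Sum>j\<in>A. c (\<psi> j) *\<^sub>R \<psi> j)"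
      by (simp add: zj)
    also have "\<dots> = x - a"
      using sum.reindex_bij_betw[OF \<psi>, of "\<lambda>b. c b *\<^sub>R b"] c by simp
    finally have s: "(\<Sum>j\<in>A. (z \<bullet> j) *\<^sub>R \<psi> j) = x - a" .
    have "z \<in> C" "y = a + \<Phi> z"
      using xt by (simp_all add: C_iff \<Phi>_eq zk s)
    then show "y \<in> (+) a ` \<Phi> ` C" by blast
  next
    fix y assume "y \<in> (+) a ` \<Phi> ` C"
    then obtain z where z: "z \<in> C" "y = a + \<Phi> z" by blast
    then have "y = (a + (\<Sum>j\<in>A. (z \<bullet> j) *\<^sub>R \<psi> j)) + (z \<bullet> k) *\<^sub>R n"
      by (simp add: \<Phi>_eq)
    then show "y \<in> ?Q"
      using z(1) C_iff[of z] by blast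
  qed
  have "bounded ?Q"
  proof -
    obtain R where R: "\<And>x. x \<in> F \<Longrightarrow> norm x \<le> R"
      using F(1) compact_imp_bounded bounded_iff by metis
    show ?thesis
      unfolding bounded_iff
    proof (intro exI ballI)
      fix y assume "y \<in> ?Q"
      then obtain x t where xt: "y = x + t *\<^sub>R n" "x \<in> F" "t \<in> {0..1}" by blast
      then show "norm y \<le> R + 1"
        using norm_triangle_ineq[of x "t *\<^sub>R n"] R[of x] n(1) by auto
    qed
  qed
  then have "bounded (\<Phi> ` C)"
    unfolding Q using bounded_translation[of "(+) a ` \<Phi> ` C" "- a"] by (simp add: image_image)
  then have "bounded C"
    using orth by (simp add: bounded_iff orthogonal_transformation)
  then have "C \<in> lmeasurable"
    using C(1) by (intro bounded_set_imp_lmeasurable) auto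
  then have "measure lebesgue (\<Phi> ` C) = measure lebesgue C"
    using measure_linear_image_cart[of \<Phi> C] orth by (simp add: orthogonal_transformation_linear)
  then have "measure lebesgue ?Q = measure lebesgue C"
    by (simp only: Q measure_translation)
  also have "\<dots> = measure lborel C"
    using C(1) by (simp add: measure_completion)
  also have "\<dots> = rel_volume F"
    using C(2) by (simp add: rv measure_def)
  finally show ?thesis by simp
qed

lemma direction_space_simplex_origin:
  "direction_space (convex hull (insert 0 W)) = span W"
  using direction_space_eq_span[of 0 "insert 0 W"]
  by (simp add: direction_space_convex_hull span_insert_0)

text \<open>The base is the standard simplex in \<open>d - 1\<close> coordinates, of product measure
  \<open>1 / (d-1)!\<close>, and the height is 1. This is the model prism whose linear images give
  the facet measures.\<close>

lemma measure_std_prism: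
  fixes k :: "real^'n"
  assumes k: "k \<in> Basis"
  defines "P \<equiv> {y + t *\<^sub>R k | y t. y \<in> convex hull (insert 0 (Basis - {k})) \<and> t \<in> {0..1}}"
  shows "P \<in> lmeasurable" "measure lebesgue P = 1 / fact (CARD('n) - 1)"
proof -
  define A where "A = Basis - {k}"
  have A: "finite A" "A \<subseteq> Basis" "card A = CARD('n) - 1"
    using k by (auto simp: A_def)
  let ?PA = "\<Pi>\<^sub>M j\<in>A. lborel :: real measure"
  define M where "M = {f. (\<forall>j\<in>A. 0 \<le> f j) \<and> sum f A \<le> 1} \<inter> space ?PA"
  have M: "M \<in> sets ?PA"
  proof -
    have "M = {f \<in> space ?PA. (\<forall>j\<in>A. 0 \<le> f j) \<and> sum f A \<le> 1}"
      by (auto simp: M_def)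
    also have "\<dots> \<in> sets ?PA"
      using A(1) by measurable
    finally show ?thesis .
  qed
  define C where "C = {x. x \<bullet> k \<in> {0..1} \<and> (\<lambda>j\<in>A. x \<bullet> j) \<in> M}"
  have C: "C \<in> sets borel" "emeasure lborel C = emeasure ?PA M"
    using emeasure_unit_cylinder[OF k, of M] M by (simp_all add: C_def A_def)
  have "emeasure ?PA M = ennreal (1 / fact (CARD('n) - 1))"
    using emeasure_std_simplex_aux[OF A(1), of 1] by (simp add: M_def A(3))
  with C have C': "emeasure lborel C = ennreal (1 / fact (CARD('n) - 1))"
    by simp
  have kj: "k \<bullet> j = 0" if "j \<in> A" for j
    using that k by (auto simp: A_def inner_Basis)
  have kk: "k \<bullet> k = 1"
    using k by simp
  have "C = P"
  proof (intro equalityI subsetI)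
    fix x assume "x \<in> C"
    then have x: "x \<bullet> k \<in> {0..1}" "\<And>j. j \<in> A \<Longrightarrow> 0 \<le> x \<bullet> j" "(\<Sum>j\<in>A. x \<bullet> j) \<le> 1"
      by (auto simp: C_def M_def)
    have "0 \<le> (x - (x \<bullet> k) *\<^sub>R k) \<bullet> j" if "j \<in> Basis" for j
      using x(2)[of j] kj[of j] kk that by (cases "j = k") (auto simp: A_def inner_diff_left)
    moreover have "(\<Sum>j\<in>A. (x - (x \<bullet> k) *\<^sub>R k) \<bullet> j) \<le> 1"
      using x(3) kj by (simp add: inner_diff_left)
    moreover have "(x - (x \<bullet> k) *\<^sub>R k) \<bullet> j = 0" if "j \<in> Basis" "j \<notin> A" for j
      using that kk by (auto simp: A_def inner_diff_left)
    ultimately have "x - (x \<bullet> k) *\<^sub>R k \<in> convex hull (insert 0 A)"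
      unfolding substd_simplex[OF A(2)] by blast
    moreover have "x = (x - (x \<bullet> k) *\<^sub>R k) + (x \<bullet> k) *\<^sub>R k"
      by simp
    ultimately show "x \<in> P"
      unfolding P_def A_def[symmetric] using x(1) by blast
  next
    fix x assume "x \<in> P"
    then obtain y t where x: "x = y + t *\<^sub>R k" "y \<in> convex hull (insert 0 A)" "t \<in> {0..1}"
      unfolding P_def A_def[symmetric] by blast
    then have y: "\<And>j. j \<in> Basis \<Longrightarrow> 0 \<le> y \<bullet> j" "(\<Sum>j\<in>A. y \<bullet> j) \<le> 1" "y \<bullet> k = 0"
      using k unfolding substd_simplex[OF A(2)] by (auto simp: A_def)
    have xj: "x \<bullet> j = y \<bullet> j" if "j \<in> A" for j
      using kj[OF that] by (simp add: x(1) inner_add_left)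
    have "x \<bullet> k = t"
      using kk y(3) by (simp add: x(1) inner_add_left)
    moreover have "0 \<le> x \<bullet> j" if "j \<in> A" for j
      using xj[OF that] y(1)[of j] A(2) that by auto
    moreover have "(\<Sum>j\<in>A. x \<bullet> j) \<le> 1"
      using y(2) sum.cong[OF refl xj, of A "\<lambda>j. j"] by simp
    ultimately show "x \<in> C"
      using x(3) by (simp add: C_def M_def space_PiM)
  qed
  have "emeasure lebesgue C = ennreal (1 / fact (CARD('n) - 1))"
    using C C' by simp
  then show "P \<in> lmeasurable" "measure lebesgue P = 1 / fact (CARD('n) - 1)"
    using C(1) unfolding \<open>C = P\<close>[symmetric] by (auto simp: fmeasurable_def measure_def)
qed

text \<open>With \<open>n\<close> in place of \<open>w i\<close>, the linear map given by the family
  takes the model prism to the prism of height 1 over the facet that omits \<open>w i\<close>; its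
  determinant is the facet measure up to the factorial.\<close>

lemma rel_volume_facet_origin:
  fixes w :: "'n::finite \<Rightarrow> real^'n"
  assumes w: "inj w" "independent (range w)"
    and n: "norm n = 1" "\<And>j. j \<noteq> i \<Longrightarrow> n \<bullet> w j = 0"
  shows "rel_volume (convex hull (insert 0 (w ` (UNIV - {i})))) =
         \<bar>det (\<chi> j. if j = i then n else w j)\<bar> / fact (CARD('n) - 1)"
proof -
  let ?F = "convex hull (insert 0 (w ` (UNIV - {i})))"
  let ?v = "\<lambda>j. if j = i then n else w j"
  let ?G = "convex hull (insert 0 (Basis - {axis i 1})) :: (real^'n) set"
  let ?P = "{y + t *\<^sub>R axis i 1 | y t. y \<in> ?G \<and> t \<in> {0..1}}"
  have i: "axis i (1::real) \<in> Basis"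
    by simp
  have "independent (w ` (UNIV - {i}))"
    by (rule independent_mono[OF w(2)]) auto
  then have "dim (span (w ` (UNIV - {i}))) = card (w ` (UNIV - {i}))"
    by (rule dim_span_eq_card_independent)
  also have "\<dots> = CARD('n) - 1"
    by (subst card_image[OF inj_on_subset[OF w(1)]]) simp_all
  finally have dim: "Suc (dim (direction_space ?F)) = CARD('n)"
    by (simp add: direction_space_simplex_origin)
  have perp: "n \<bullet> u = 0" if "u \<in> direction_space ?F" for u
  proof -
    have "span (w ` (UNIV - {i})) \<subseteq> {u. n \<bullet> u = 0}"
      using n(2) by (intro span_minimal subspace_hyperplane) auto
    with that show ?thesis
      unfolding direction_space_simplex_origin by blast
  qed
  have rv: "rel_volume ?F = measure lebesgue {x + t *\<^sub>R n | x t. x \<in> ?F \<and> t \<in> {0..1}}"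
    by (rule rel_volume_eq_measure_prism[OF _ _ dim n(1) perp])
       (auto intro: finite_imp_compact_convex_hull)
  have prism: "{x + t *\<^sub>R n | x t. x \<in> ?F \<and> t \<in> {0..1}} = row_comb ?v ` ?P"
  proof -
    have Basis: "Basis - {axis i 1} = (\<lambda>j. axis j (1::real)) ` (UNIV - {i})"
      unfolding Basis_vec_def by (auto simp: axis_eq_axis)
    have "row_comb ?v ` insert 0 (Basis - {axis i 1}) = insert 0 (w ` (UNIV - {i}))"
      unfolding Basis image_insert linear_0[OF linear_row_comb] image_image row_comb_axis
      by (simp cong: image_cong_simp)
    then have F: "?F = row_comb ?v ` ?G"
      using convex_hull_linear_image[OF linear_row_comb, of ?v "insert 0 (Basis - {axis i 1})"] by (simp only:)
    have "row_comb ?v (y + t *\<^sub>R axis i 1) = row_comb ?v y + t *\<^sub>R n" for y t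
      by (simp add: linear_add[OF linear_row_comb] linear_scale[OF linear_row_comb] row_comb_axis)
    then show ?thesis
      unfolding F by (force simp: image_iff)
  qed
  show ?thesis
    unfolding rv prism measure_row_comb_image[OF measure_std_prism(1)[OF i]] measure_std_prism(2)[OF i]
    by simp
qed

section \<open>Heights, Cramer's rule and the \<open>d\<close>-sine\<close>

lemma independent_family_basis:
  fixes w :: "'n::finite \<Rightarrow> real^'n"
  assumes "inj w" "independent (range w)"
  shows "surj (row_comb w)" "det (\<chi> i. w i) \<noteq> 0"
proof -
  have "dim (range w) = DIM(real^'n)"
    using assms by (simp add: dim_eq_card_independent card_image)
  then have full: "span (range w) = UNIV"
    by (rule dim_eq_full[THEN iffD1])
  have "range w \<subseteq> range (row_comb w)"
    using row_comb_axis[of w] by (metis image_subsetI rangeI)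
  then have "span (range w) \<subseteq> range (row_comb w)"
    by (intro span_minimal) (auto intro: linear_subspace_image linear_row_comb)
  then show "surj (row_comb w)"
    unfolding full by (rule top_le)
  then have "inj (row_comb w)"
    using linear_surjective_imp_injective[OF linear_row_comb[of w]] by simp
  then show "det (\<chi> i. w i) \<noteq> 0"
    using det_nz_iff_inj[OF linear_row_comb[of w]] by (simp add: det_matrix_row_comb)
qed

text \<open>Volume is base times height. With \<open>x\<close> the coefficients of \<open>n\<close>
  in the basis \<open>w\<close>, Cramer's rule gives the factor \<open>x $ i\<close> between the two
  determinants, and pairing \<open>n\<close> with itself leaves
  \<open>1 = x $ i * (n \<bullet> w i)\<close>.\<close>

lemma det_replace_row_by_normal:
  fixes w :: "'n::finite \<Rightarrow> real^'n"
  assumes w: "inj w" "independent (range w)"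
    and n: "norm n = 1" "\<And>j. j \<noteq> i \<Longrightarrow> n \<bullet> w j = 0"
  shows "det (\<chi> j. if j = i then n else w j) * (n \<bullet> w i) = det (\<chi> j. w j)"
proof -
  obtain x where x: "n = row_comb w x"
    using independent_family_basis(1)[OF w] by (metis surjD)
  have "det (\<chi> j. if j = i then n else w j) = x $ i * det (\<chi> j. w j)"
  proof -
    have row: "row j (\<chi> j. w j) = w j" for j
      by (simp add: vec_eq_iff row_def)
    show ?thesis
      using cramer_lemma_transpose[of i x "\<chi> j. w j"]
      unfolding row scalar_mult_eq_scaleR row_comb_def[symmetric] x[symmetric] .
  qed
  moreover have "1 = x $ i * (n \<bullet> w i)"
  proof -
    have "1 = n \<bullet> row_comb w x"
      using n(1) x by (simp add: norm_eq_1)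
    also have "\<dots> = (\<Sum>j\<in>UNIV. x $ j * (n \<bullet> w j))"
      by (simp add: row_comb_def inner_sum_right)
    also have "\<dots> = (\<Sum>j\<in>UNIV. if j = i then x $ j * (n \<bullet> w j) else 0)"
      using n(2) by (intro sum.cong) auto
    finally show ?thesis by simp
  qed
  ultimately show ?thesis
    by (metis mult.assoc mult.commute mult.right_neutral)
qed

text \<open>With \<open>D\<close> the absolute determinant and
  \<open>h_i = n i \<bullet> w i\<close> the heights, the simplex has volume \<open>D / d!\<close>
  and the facet omitting \<open>w i\<close> has measure \<open>D / (h_i * (d-1)!)\<close>. In the
  defining quotient all factorials and powers of \<open>d\<close> cancel, and a single
  \<open>D\<close> stays in the denominator.\<close>

lemma d_sine_eq_prod_heights:
  fixes w n :: "'n::finite \<Rightarrow> real^'n"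
  assumes w: "inj w" "independent (range w)"
    and n: "\<And>i. norm (n i) = 1" "\<And>i j. j \<noteq> i \<Longrightarrow> n i \<bullet> w j = 0"
    and pos: "\<And>i. 0 < n i \<bullet> w i"
  shows "d_sine (range w) = (\<Prod>i\<in>UNIV. n i \<bullet> w i) / \<bar>det (\<chi> i. w i)\<bar>"
proof -
  define d where "d = CARD('n)"
  define D where "D = \<bar>det (\<chi> i. w i)\<bar>"
  define H where "H = (\<Prod>i\<in>UNIV. n i \<bullet> w i)"
  have D: "D > 0"
    using independent_family_basis(2)[OF w] by (simp add: D_def)
  have H: "H > 0"
    using pos by (simp add: H_def prod_pos)
  have d: "d > 0" by (simp add: d_def)
  have w0: "w i \<noteq> 0" for i
    using w(2) dependent_zero by (metis rangeI)
  have facet: "rel_volume (convex hull (insert 0 (range w) - {w i})) = D / ((n i \<bullet> w i) * fact (d - 1))" for i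
  proof -
    have "insert 0 (range w) - {w i} = insert 0 (w ` (UNIV - {i}))"
      using w0[of i] w(1) by (auto simp: inj_def)
    moreover have "D = \<bar>det (\<chi> j. if j = i then n i else w j)\<bar> * (n i \<bullet> w i)"
    proof -
      have "det (\<chi> j. if j = i then n i else w j) * (n i \<bullet> w i) = det (\<chi> j. w j)"
        by (rule det_replace_row_by_normal[OF w]) (use n in auto)
      from arg_cong[OF this, of abs] show ?thesis
        using pos[of i] by (simp add: D_def abs_mult)
    qed
    then have "\<bar>det (\<chi> j. if j = i then n i else w j)\<bar> = D / (n i \<bullet> w i)"
      using pos[of i] by simp
    ultimately show ?thesis
      using rel_volume_facet_origin[OF w, of "n i" i] n by (simp add: d_def)
  qed
  have "insert 0 (range w) - {0} = range w"
    using w0 by (metis Diff_insert_absorb imageE)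
  then have "(\<Prod>b\<in>insert 0 (range w) - {0}. rel_volume (convex hull (insert 0 (range w) - {b})))
      = (\<Prod>i\<in>UNIV. D / ((n i \<bullet> w i) * fact (d - 1)))"
    by (simp add: prod.reindex[OF w(1)] facet)
  also have "\<dots> = D ^ d / (H * fact (d - 1) ^ d)"
    by (simp add: prod_dividef prod.distrib H_def d_def)
  finally have P: "(\<Prod>b\<in>insert 0 (range w) - {0}. rel_volume (convex hull (insert 0 (range w) - {b})))
      = D ^ d / (H * fact (d - 1) ^ d)" .
  have "d_sine (range w) =
     real d ^ (d - 1) * (D / fact d) ^ (d - 1) / (fact (d - 1) * (D ^ d / (H * fact (d - 1) ^ d)))"
    using w(2) unfolding d_sine_def vertex_sine_def P measure_simplex_origin
    by (simp add: d_def D_def)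
  also have "(fact d :: real) = real d * fact (d - 1)"
    using d by (simp add: fact_reduce)
  also have "real d ^ (d - 1) * (D / (real d * fact (d - 1))) ^ (d - 1) / (fact (d - 1) * (D ^ d / (H * fact (d - 1) ^ d))) = H / D"
  proof -
    \<comment> \<open>The letters stand for \<open>d^(d-1)\<close>, \<open>D^(d-1)\<close>,
      \<open>((d-1)!)^(d-1)\<close> and \<open>(d-1)!\<close>; treating the powers as opaque
      positive numbers reduces the cancellation to field arithmetic.\<close>
    have eq: "s * (q / (s * r)) / (f * ((D * q) / (H * (f * r)))) = H / D"
      if "s > 0" "q > 0" "r > 0" "f > 0" for s q r f :: real
      using that D H by (simp add: divide_simps)
    have "D ^ d = D * D ^ (d - 1)" "(fact (d - 1) :: real) ^ d = fact (d - 1) * fact (d - 1) ^ (d - 1)"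
      using d by (simp_all only: power_minus_mult[symmetric] mult.commute)
    then show ?thesis
      unfolding power_divide power_mult_distrib
      using eq[of "real d ^ (d - 1)" "D ^ (d - 1)" "fact (d - 1) ^ (d - 1)" "fact (d - 1)"] D d
      by (simp only: zero_less_power fact_gt_zero of_nat_0_less_iff)
  qed
  finally show ?thesis
    by (simp add: H_def D_def)
qed

text \<open>The two families are biorthogonal, so the matrix of normals times the transposed matrix
  of vectors is diagonal. Dividing by the determinant of \<open>w\<close> leaves that of the unit
  normals, which does not see edge lengths.\<close>

lemma prod_heights_eq_det_normals:
  fixes w n :: "'n::finite \<Rightarrow> real^'n"
  assumes "\<And>i j. j \<noteq> i \<Longrightarrow> n i \<bullet> w j = 0"
  shows "(\<Prod>i\<in>UNIV. n i \<bullet> w i) = det (\<chi> i. n i) * det (\<chi> i. w i)"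
proof -
  have "(\<chi> i. n i) ** transpose (\<chi> i. w i) = (\<chi> i j. if i = j then n i \<bullet> w i else 0)"
  proof -
    have "((\<chi> i. n i) ** transpose (\<chi> i. w i)) $ i $ j = n i \<bullet> w j" for i j
      by (simp add: matrix_matrix_mult_def transpose_def inner_vec_def)
    then show ?thesis
      using assms by (simp add: vec_eq_iff)
  qed
  from arg_cong[OF this, of det] show ?thesis
    by (simp add: det_diagonal det_mul)
qed

section \<open>Facet normals and wide edges\<close>

lemma inner_zero_on_direction_space:
  fixes S :: "'a::euclidean_space set"
  assumes "x0 \<in> S" "\<And>x. x \<in> S \<Longrightarrow> v \<bullet> (x - x0) = 0" "u \<in> direction_space S"
  shows "v \<bullet> u = 0"
proof -
  have "span ((\<lambda>x. x - x0) ` S) \<subseteq> {u. v \<bullet> u = 0}"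
    using assms(2) by (intro span_minimal subspace_hyperplane) auto
  then show ?thesis
    using assms(3) direction_space_eq_span[OF assms(1)] by blast
qed

lemma diff_in_direction_space: "x \<in> S \<Longrightarrow> y \<in> S \<Longrightarrow> x - y \<in> direction_space S"
  unfolding direction_space_def using hull_inc[of x S affine] hull_inc[of y S affine] by blast

lemma direction_space_mono: "S \<subseteq> T \<Longrightarrow> direction_space S \<subseteq> direction_space T"
  unfolding direction_space_def using hull_mono[of S T affine] by blast

text \<open>The outward unit normal of the facet opposite to \<open>c\<close>, expressed through
  vertices alone, so that neither convex hulls nor a definite description enter the estimates. The
  strict inequality fixes the sign.\<close>

definition facet_normal :: "'a::euclidean_space set \<Rightarrow> 'a \<Rightarrow> 'a \<Rightarrow> bool" where
  "facet_normal C c n \<longleftrightarrow> norm n = 1 \<and> n \<in> direction_space C \<and>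
     (\<forall>x\<in>C - {c}. \<forall>y\<in>C - {c}. n \<bullet> (x - y) = 0) \<and> (\<forall>x\<in>C - {c}. n \<bullet> (c - x) < 0)"

text \<open>The component \<open>z\<close> of \<open>c - x0\<close> orthogonal to the facet points
  from the facet to \<open>c\<close>. Affine independence makes it nonzero, and the outward normal
  is its negative, normalized.\<close>

lemma facet_normal_exists:
  fixes C :: "'a::euclidean_space set"
  assumes C: "\<not> affine_dependent C" and c: "c \<in> C" and x0: "x0 \<in> C - {c}"
  shows "\<exists>n. facet_normal C c n"
proof -
  let ?D = "(\<lambda>x. x - x0) ` (C - {c})"
  obtain y z where y: "y \<in> span ?D" and z: "\<And>w. w \<in> span ?D \<Longrightarrow> orthogonal z w" and yz: "c - x0 = y + z"
    using orthogonal_subspace_decomp_exists by blast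
  have D: "direction_space (C - {c}) = span ?D"
    by (rule direction_space_eq_span[OF x0])
  have "z \<noteq> 0"
  proof
    assume "z = 0"
    then have "c - x0 \<in> span ?D"
      using y yz by simp
    then obtain x where "x \<in> affine hull (C - {c})" "c - x0 = x - x0"
      using diffs_affine_hull_span[OF x0] by (metis imageE)
    then have "c \<in> affine hull (C - {c})" by simp
    with C c show False
      by (auto simp: affine_dependent_def)
  qed
  have sub: "subspace (direction_space C)"
    using subspace_direction_space c by blast
  have "y \<in> direction_space C"
    using direction_space_mono[of "C - {c}" C] D y by blast
  moreover have "c - x0 \<in> direction_space C"
    using c x0 by (simp add: diff_in_direction_space)
  moreover have "z = (c - x0) - y"
    using yz by simp
  ultimately have zC: "z \<in> direction_space C"
    using subspace_diff[OF sub] by blast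
  have perp: "z \<bullet> (x - y) = 0" if "x \<in> C - {c}" "y \<in> C - {c}" for x y
    using z[of "x - y"] diff_in_direction_space[OF that] D by (simp add: orthogonal_def)
  have "z \<bullet> (c - x0) = z \<bullet> z"
    using z[OF y] by (simp add: yz inner_add_right orthogonal_def)
  then have h: "z \<bullet> (c - x) = z \<bullet> z" if "x \<in> C - {c}" for x
    using perp[OF x0 that] by (simp add: inner_diff_right)
  have "facet_normal C c (- z /\<^sub>R norm z)"
    unfolding facet_normal_def
  proof (intro conjI ballI)
    show "- z /\<^sub>R norm z \<in> direction_space C"
      using zC sub by (simp add: subspace_neg subspace_scale)
  qed (use \<open>z \<noteq> 0\<close> perp h in \<open>auto simp: zero_less_mult_iff\<close>)
  then show ?thesis ..
qed

text \<open>Subtracting from \<open>v\<close> the multiple of \<open>n\<close> that cancels the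
  product with \<open>c - x0\<close> leaves a vector of \<open>direction_space C\<close> orthogonal
  to that whole space, hence 0.\<close>

lemma facet_normal_unique_direction:
  fixes C :: "'a::euclidean_space set"
  assumes n: "facet_normal C c n" and c: "c \<in> C" and x0: "x0 \<in> C - {c}"
    and v: "v \<in> direction_space C" "\<And>x y. x \<in> C - {c} \<Longrightarrow> y \<in> C - {c} \<Longrightarrow> v \<bullet> (x - y) = 0"
  shows "v = (v \<bullet> n) *\<^sub>R n"
proof -
  define s where "s = v \<bullet> (c - x0) / (n \<bullet> (c - x0))"
  have neg: "n \<bullet> (c - x0) < 0"
    using n x0 by (simp add: facet_normal_def)
  have sub: "subspace (direction_space C)"
    using subspace_direction_space c by blast
  have "(v - s *\<^sub>R n) \<bullet> (x - x0) = 0" if "x \<in> C" for x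
  proof (cases "x = c")
    case True
    then show ?thesis using neg by (simp add: s_def inner_diff_left)
  next
    case False
    then show ?thesis
      using n v(2)[of x x0] x0 that by (simp add: facet_normal_def inner_diff_left)
  qed
  moreover have "v - s *\<^sub>R n \<in> direction_space C"
    using v(1) n sub by (simp add: facet_normal_def subspace_diff subspace_scale)
  ultimately have "(v - s *\<^sub>R n) \<bullet> (v - s *\<^sub>R n) = 0"
    using inner_zero_on_direction_space x0 by (metis DiffD1)
  then have "v = s *\<^sub>R n" by simp
  moreover have "n \<bullet> n = 1"
    using n by (simp add: facet_normal_def norm_eq_1)
  ultimately show ?thesis by simp
qed

lemma facet_normal_project:
  fixes C :: "'a::euclidean_space set"
  assumes n: "facet_normal C c n" and c: "c \<in> C" and x0: "x0 \<in> C - {c}"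
    and u: "u \<in> direction_space C"
  shows "u - (u \<bullet> n) *\<^sub>R n \<in> direction_space (C - {c})"
proof -
  let ?D = "(\<lambda>x. x - x0) ` (C - {c})"
  have D: "direction_space (C - {c}) = span ?D"
    by (rule direction_space_eq_span[OF x0])
  have sub: "subspace (direction_space C)"
    using subspace_direction_space c by blast
  obtain y z where y: "y \<in> span ?D" and z: "\<And>w. w \<in> span ?D \<Longrightarrow> orthogonal z w" and yz: "u = y + z"
    using orthogonal_subspace_decomp_exists by blast
  have "y \<in> direction_space C"
    using direction_space_mono[of "C - {c}" C] D y by blast
  then have "z \<in> direction_space C"
    using u yz subspace_diff[OF sub, of u y] by simp
  moreover have "z \<bullet> (x - y) = 0" if "x \<in> C - {c}" "y \<in> C - {c}" for x y
    using z[of "x - y"] diff_in_direction_space[OF that] D by (simp add: orthogonal_def)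
  ultimately have "z = (z \<bullet> n) *\<^sub>R n"
    using facet_normal_unique_direction[OF n c x0] by blast
  moreover have "n \<bullet> y = 0"
  proof (rule inner_zero_on_direction_space[OF x0])
    show "y \<in> direction_space (C - {c})" using y D by simp
  qed (use n x0 in \<open>simp add: facet_normal_def\<close>)
  then have "u \<bullet> n = z \<bullet> n"
    by (simp add: yz inner_add_left inner_commute[of y])
  ultimately have "u - (u \<bullet> n) *\<^sub>R n = y"
    by (metis add_diff_cancel_right' yz)
  then show ?thesis using y D by simp
qed

text \<open>For uniqueness, any candidate is a multiple of \<open>n\<close>, and unit length leaves
  the factors 1 and -1. The product of \<open>n\<close> with \<open>c - x0\<close> is strictly
  negative and that of the candidate is not positive, which excludes -1.\<close>

lemma outward_unit_normal_simplex:
  fixes C :: "'a::euclidean_space set"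
  assumes n: "facet_normal C c n" and c: "c \<in> C" and x0: "x0 \<in> C - {c}"
  shows "outward_unit_normal (convex hull C) (convex hull (C - {c})) = n"
  unfolding outward_unit_normal_def direction_space_convex_hull
proof (rule the_equality)
  have F: "convex hull (C - {c}) \<subseteq> {x. n \<bullet> x = n \<bullet> x0}"
  proof (rule hull_minimal)
    show "C - {c} \<subseteq> {x. n \<bullet> x = n \<bullet> x0}"
    proof
      fix x assume "x \<in> C - {c}"
      then have "n \<bullet> (x - x0) = 0"
        using n x0 unfolding facet_normal_def by blast
      then show "x \<in> {x. n \<bullet> x = n \<bullet> x0}"
        by (simp add: inner_diff_right)
    qed
  qed (rule convex_hyperplane)
  have S: "convex hull C \<subseteq> {x. n \<bullet> x \<le> n \<bullet> x0}"
  proof (rule hull_minimal)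
    show "C \<subseteq> {x. n \<bullet> x \<le> n \<bullet> x0}"
    proof
      fix x assume "x \<in> C"
      moreover have "n \<bullet> (c - x0) < 0" and "x \<in> C - {c} \<Longrightarrow> n \<bullet> (x - x0) = 0"
        using n x0 unfolding facet_normal_def by blast+
      ultimately show "x \<in> {x. n \<bullet> x \<le> n \<bullet> x0}"
        by (cases "x = c") (auto simp: inner_diff_right)
    qed
  qed (rule convex_halfspace_le)
  show "norm n = 1 \<and> n \<in> direction_space C \<and>
      (\<forall>x\<in>convex hull (C - {c}). \<forall>y\<in>convex hull (C - {c}). n \<bullet> (x - y) = 0) \<and>
      (\<forall>x\<in>convex hull (C - {c}). \<forall>y\<in>convex hull C. n \<bullet> (y - x) \<le> 0)"
  proof (intro conjI ballI)
    show "n \<bullet> (x - y) = 0" if "x \<in> convex hull (C - {c})" "y \<in> convex hull (C - {c})" for x y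
    proof -
      have "n \<bullet> x = n \<bullet> x0" "n \<bullet> y = n \<bullet> x0"
        using F that by blast+
      then show ?thesis by (simp add: inner_diff_right)
    qed
    show "n \<bullet> (y - x) \<le> 0" if "x \<in> convex hull (C - {c})" "y \<in> convex hull C" for x y
    proof -
      have "n \<bullet> x = n \<bullet> x0" "n \<bullet> y \<le> n \<bullet> x0"
        using F S that by blast+
      then show ?thesis by (simp add: inner_diff_right)
    qed
  qed (use n in \<open>simp_all add: facet_normal_def\<close>)
next
  fix n'
  assume n': "norm n' = 1 \<and> n' \<in> direction_space C \<and>
      (\<forall>x\<in>convex hull (C - {c}). \<forall>y\<in>convex hull (C - {c}). n' \<bullet> (x - y) = 0) \<and>
      (\<forall>x\<in>convex hull (C - {c}). \<forall>y\<in>convex hull C. n' \<bullet> (y - x) \<le> 0)"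
  have inc: "x \<in> convex hull (C - {c})" if "x \<in> C - {c}" for x
    using that by (rule hull_inc)
  have "c \<in> convex hull C"
    using c by (rule hull_inc)
  with n' x0 inc have le: "n' \<bullet> (c - x0) \<le> 0"
    by blast
  have "n' \<bullet> (x - y) = 0" if "x \<in> C - {c}" "y \<in> C - {c}" for x y
    using n' inc that by blast
  then have eq: "n' = (n' \<bullet> n) *\<^sub>R n"
    using facet_normal_unique_direction[OF n c x0] n' by blast
  have "norm n = 1" "n \<bullet> (c - x0) < 0"
    using n x0 by (auto simp: facet_normal_def)
  moreover have "\<bar>n' \<bullet> n\<bar> * norm n = 1"
    using n' eq by (metis norm_scaleR)
  moreover have "n' \<bullet> (c - x0) = (n' \<bullet> n) * (n \<bullet> (c - x0))"
    by (subst eq) simp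
  ultimately have "n' \<bullet> n = 1"
    using le by (auto simp: mult_le_0_iff abs_if split: if_splits)
  with eq show "n' = n" by simp
qed

text \<open>Directions are tested only within the affine hull, so that the notion makes sense for
  lower-dimensional faces. The condition \<open>a \<noteq> b\<close> excludes the trivial choice for
  which both sides vanish.\<close>

definition edge_wide :: "real \<Rightarrow> 'a::euclidean_space set \<Rightarrow> bool" where
  "edge_wide m C \<longleftrightarrow>
     (\<forall>u\<in>direction_space C. \<exists>a\<in>C. \<exists>b\<in>C. a \<noteq> b \<and> m * norm u * norm (a - b) \<le> \<bar>u \<bullet> (a - b)\<bar>)"

lemma edge_wide_mono:
  assumes "edge_wide m C" "m' \<le> m"
  shows "edge_wide m' C"
  unfolding edge_wide_def
proof
  fix u assume "u \<in> direction_space C"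
  then obtain a b where ab: "a \<in> C" "b \<in> C" "a \<noteq> b" "m * norm u * norm (a - b) \<le> \<bar>u \<bullet> (a - b)\<bar>"
    using assms(1) unfolding edge_wide_def by blast
  have "m' * (norm u * norm (a - b)) \<le> m * (norm u * norm (a - b))"
    using assms(2) by (intro mult_right_mono) auto
  with ab show "\<exists>a\<in>C. \<exists>b\<in>C. a \<noteq> b \<and> m' * norm u * norm (a - b) \<le> \<bar>u \<bullet> (a - b)\<bar>"
    by (intro bexI[of _ a] bexI[of _ b]) (auto simp: mult.assoc)
qed

lemma facet_normal_perp:
  assumes "facet_normal C c n" "x0 \<in> C - {c}" "u \<in> direction_space (C - {c})"
  shows "n \<bullet> u = 0"
  using inner_zero_on_direction_space[OF assms(2) _ assms(3), of n] assms(1,2)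
  unfolding facet_normal_def by blast

text \<open>A direction \<open>u\<close> of the facet that is nearly orthogonal to all edges of the facet is tilted
  along the facet normal until it is orthogonal to the edge from \<open>c\<close> to its nearest vertex; the
  other edges at \<open>c\<close> are then no worse than edges of the facet, up to a factor 2.\<close>

lemma edge_wide_facet:
  fixes C :: "'a::euclidean_space set"
  assumes C: "\<not> affine_dependent C" and c: "c \<in> C" and pq: "p \<in> C - {c}" "q \<in> C - {c}" "p \<noteq> q"
    and m: "m > 0" and wide: "edge_wide m C"
  shows "edge_wide (m / 2) (C - {c})"
  unfolding edge_wide_def
proof
  let ?C = "C - {c}"
  fix u assume u: "u \<in> direction_space ?C"
  show "\<exists>a\<in>?C. \<exists>b\<in>?C. a \<noteq> b \<and> m / 2 * norm u * norm (a - b) \<le> \<bar>u \<bullet> (a - b)\<bar>"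
  proof (cases "u = 0")
    case True
    then show ?thesis
      using pq by (intro bexI[of _ p] bexI[of _ q]) auto
  next
    case False
    obtain n where n: "facet_normal C c n"
      using facet_normal_exists[OF C c pq(1)] by blast
    have "finite ?C"
      using aff_independent_finite[OF C] by simp
    then obtain b0 where b0: "b0 \<in> ?C" "\<And>b. b \<in> ?C \<Longrightarrow> norm (c - b0) \<le> norm (c - b)"
      using pq(1) ex_min_if_finite[of "(\<lambda>b. norm (c - b)) ` ?C"] by (force simp: not_less)
    define s where "s = u \<bullet> (c - b0) / (n \<bullet> (c - b0))"
    define v where "v = u - s *\<^sub>R n"
    have sub: "subspace (direction_space C)"
      using subspace_direction_space c by blast
    have "u \<in> direction_space C" "n \<in> direction_space C"
      using u direction_space_mono[of ?C C] n by (auto simp: facet_normal_def)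
    then have vC: "v \<in> direction_space C"
      unfolding v_def using sub by (simp add: subspace_diff subspace_scale)
    have nv: "n \<bullet> (x - y) = 0" if "x \<in> ?C" "y \<in> ?C" for x y
      using n that unfolding facet_normal_def by blast
    have "n \<bullet> (c - b0) \<noteq> 0"
      using n b0(1) unfolding facet_normal_def by force
    then have v0: "v \<bullet> (c - b0) = 0"
      by (simp add: v_def s_def inner_diff_left)
    have "u \<bullet> n = 0"
      using facet_normal_perp[OF n b0(1) u] by (simp add: inner_commute)
    moreover have "n \<bullet> n = 1"
      using n by (simp add: facet_normal_def norm_eq_1)
    \<comment> \<open>Pythagoras: tilting along \<open>n\<close>, which is orthogonal to
      \<open>u\<close>, can only lengthen \<open>u\<close>, so lower bounds in terms of
      \<open>norm v\<close> are also bounds in terms of \<open>norm u\<close>.\<close>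
    ultimately have "v \<bullet> v = u \<bullet> u + s * s"
      by (simp add: v_def inner_diff_left inner_diff_right inner_commute)
    then have "norm u \<le> norm v"
      by (simp add: norm_le)
    then have "norm v > 0"
      using False by (smt (verit) zero_less_norm_iff)
    have vin: "v \<bullet> (x - y) = u \<bullet> (x - y)" if "x \<in> ?C" "y \<in> ?C" for x y
      using nv[OF that] by (simp add: v_def inner_diff_left)
    obtain a b where ab: "a \<in> C" "b \<in> C" "a \<noteq> b" "m * norm v * norm (a - b) \<le> \<bar>v \<bullet> (a - b)\<bar>"
      using wide vC unfolding edge_wide_def by blast
    have le: "m * norm u * norm (x - y) \<le> m * norm v * norm (x - y)" for x y :: 'a
      using \<open>norm u \<le> norm v\<close> m by (intro mult_right_mono mult_left_mono) auto
    have half: "m / 2 * norm u * norm (x - y) \<le> m * norm u * norm (x - y)" for x y :: 'a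
      using m by (intro mult_right_mono) auto
    have at_c: ?thesis if b: "b \<in> ?C" "m * norm v * norm (c - b) \<le> \<bar>v \<bullet> (c - b)\<bar>" for b
    proof -
      \<comment> \<open>As \<open>v\<close> is orthogonal to \<open>c - b0\<close>, the vertex
        \<open>c\<close> may be traded for \<open>b0\<close>, which lies in the facet, where
        \<open>u\<close> and \<open>v\<close> have the same products.\<close>
      have "v \<bullet> (c - b) = v \<bullet> (b0 - b)"
        using v0 by (simp add: inner_diff_right)
      then have eq: "v \<bullet> (c - b) = u \<bullet> (b0 - b)"
        using vin[OF b0(1) b(1)] by simp
      have "m * norm v * norm (c - b) > 0"
        using m \<open>norm v > 0\<close> b(1) by auto
      then have "b0 \<noteq> b"
        using b(2) eq by auto
      have "norm (b0 - b) \<le> norm (c - b0) + norm (c - b)"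
        by (metis norm_minus_commute norm_triangle_ineq diff_add_cancel add_diff_eq)
      also have "\<dots> \<le> 2 * norm (c - b)"
        using b0(2)[OF b(1)] by simp
      finally have "m / 2 * norm u * norm (b0 - b) \<le> m / 2 * norm u * (2 * norm (c - b))"
        using m by (intro mult_left_mono) auto
      also have "\<dots> = m * norm u * norm (c - b)"
        by simp
      also have "\<dots> \<le> \<bar>u \<bullet> (b0 - b)\<bar>"
        using le[of c b] b(2) eq by simp
      finally show ?thesis
        using b0(1) b(1) \<open>b0 \<noteq> b\<close> by blast
    qed
    consider "a = c" "b \<in> ?C" | "b = c" "a \<in> ?C" | "a \<in> ?C" "b \<in> ?C"
      using ab by blast
    then show ?thesis
    proof cases
      case 1
      then show ?thesis using at_c ab(4) by blast
    next
      case 2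
      then have "m * norm v * norm (c - a) \<le> \<bar>v \<bullet> (c - a)\<bar>"
        using ab(4) by (metis norm_minus_commute abs_minus_commute inner_diff_right)
      then show ?thesis using at_c 2 by blast
    next
      case 3
      then have "m / 2 * norm u * norm (a - b) \<le> \<bar>u \<bullet> (a - b)\<bar>"
        using ab(4) le[of a b] half[of a b] vin[OF 3] by simp
      then show ?thesis using 3 ab(3) by blast
    qed
  qed
qed

text \<open>Vertices outside \<open>C'\<close> are removed one at a time, each at the price of a
  factor 2; the exponent counts them. Two vertices of \<open>C'\<close> guarantee that an edge
  remains at every stage.\<close>

lemma edge_wide_face:
  fixes C :: "'a::euclidean_space set"
  assumes "\<not> affine_dependent C" "C' \<subseteq> C" "card C' \<ge> 2" "m > 0" "edge_wide m C"
  shows "edge_wide (m / 2 ^ (card C - card C')) C'"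
  using assms
proof (induction "card C - card C'" arbitrary: C m)
  case 0
  then have "C' = C"
    using aff_independent_finite[OF 0(2)] by (intro card_seteq) auto
  with 0 show ?case by simp
next
  case (Suc k)
  have fin: "finite C"
    using aff_independent_finite[OF Suc(3)] .
  then have "C' \<noteq> C"
    using Suc(2) by auto
  then obtain c where c: "c \<in> C" "c \<notin> C'"
    using Suc(4) by blast
  obtain p q where pq: "p \<in> C'" "q \<in> C'" "p \<noteq> q"
    using Suc(5) by (metis card_le_Suc0_iff_eq card.infinite not_less_eq_eq numeral_2_eq_2 zero_le)
  have "edge_wide (m / 2) (C - {c})"
    by (rule edge_wide_facet[OF Suc(3) c(1), of p q]) (use Suc pq c in auto)
  moreover have "k = card (C - {c}) - card C'"
    using Suc(2) c fin by (simp add: card_Diff_singleton)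
  moreover have "\<not> affine_dependent (C - {c})"
    using affine_independent_subset[OF Suc(3)] by blast
  ultimately have "edge_wide (m / 2 / 2 ^ k) C'"
    using Suc(1)[of "C - {c}" "m / 2"] Suc(4,5,6) c(2) by (auto simp: subset_Diff_insert)
  then show ?case
    by (simp add: Suc(2)[symmetric])
qed

text \<open>Wideness is tested on \<open>n\<^sub>i\<close> itself. It vanishes on the edges of the
  facet opposite to \<open>i\<close>, so the wide edge has \<open>i\<close> as an endpoint. There
  \<open>n\<^sub>j\<close> vanishes or, if \<open>j\<close> is the other endpoint, has the opposite
  sign; so the product of the edge with \<open>n\<^sub>i - n\<^sub>j\<close> is no smaller, and
  Cauchy-Schwarz gives the bound.\<close>

lemma edge_wide_imp_normals_apart:
  fixes C :: "'a::euclidean_space set"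
  assumes wide: "edge_wide m C" and m: "m > 0"
    and ij: "i \<in> C" "j \<in> C" "i \<noteq> j"
    and ni: "facet_normal C i n\<^sub>i" and nj: "facet_normal C j n\<^sub>j"
  shows "m \<le> norm (n\<^sub>i - n\<^sub>j)"
proof -
  have norm: "norm n\<^sub>i = 1" and "n\<^sub>i \<in> direction_space C"
    using ni by (auto simp: facet_normal_def)
  then obtain a b where ab: "a \<in> C" "b \<in> C" "a \<noteq> b" "m * norm (a - b) \<le> \<bar>n\<^sub>i \<bullet> (a - b)\<bar>"
    using wide unfolding edge_wide_def by force
  have at_i: ?thesis if b: "b \<in> C - {i}" "m * norm (i - b) \<le> \<bar>n\<^sub>i \<bullet> (i - b)\<bar>" for b
  proof -
    have "\<bar>n\<^sub>i \<bullet> (i - b)\<bar> \<le> \<bar>(n\<^sub>i - n\<^sub>j) \<bullet> (i - b)\<bar>"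
    proof (cases "b = j")
      case True
      have "n\<^sub>i \<bullet> (i - j) < 0" "n\<^sub>j \<bullet> (j - i) < 0"
        using ni nj ij unfolding facet_normal_def by blast+
      then show ?thesis
        by (simp add: True inner_diff_left inner_diff_right)
    next
      case False
      then have "n\<^sub>j \<bullet> (i - b) = 0"
        using nj ij b(1) unfolding facet_normal_def by blast
      then show ?thesis
        by (simp add: inner_diff_left)
    qed
    also have "\<dots> \<le> norm (n\<^sub>i - n\<^sub>j) * norm (i - b)"
      by (rule Cauchy_Schwarz_ineq2)
    finally have "m * norm (i - b) \<le> norm (n\<^sub>i - n\<^sub>j) * norm (i - b)"
      using b(2) by simp
    then show ?thesis
      using b(1) by (auto dest: mult_right_le_imp_le)
  qed
  consider "a = i" | "b = i" | "a \<in> C - {i}" "b \<in> C - {i}"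
    using ab by blast
  then show ?thesis
  proof cases
    case 1
    then show ?thesis using at_i ab by blast
  next
    case 2
    then have "m * norm (i - a) \<le> \<bar>n\<^sub>i \<bullet> (i - a)\<bar>"
      using ab(4) by (metis norm_minus_commute abs_minus_commute inner_diff_right)
    then show ?thesis using at_i ab 2 by blast
  next
    case 3
    then have "n\<^sub>i \<bullet> (a - b) = 0"
      using ni unfolding facet_normal_def by blast
    moreover have "m * norm (a - b) > 0"
      using m ab(3) by simp
    ultimately show ?thesis using ab(4) by simp
  qed
qed

text \<open>Dihedral angles bounded away from \<pi>, written as chord lengths. Three vertices mean
  dimension 2, where dihedral angles start. Ranging over all subsets makes the property pass to
  faces, as induction requires.\<close>

definition normals_separated :: "real \<Rightarrow> 'a::euclidean_space set \<Rightarrow> bool" where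
  "normals_separated \<delta> C \<longleftrightarrow>
     (\<forall>C'\<subseteq>C. card C' \<ge> 3 \<longrightarrow> (\<forall>i\<in>C'. \<forall>j\<in>C'. \<forall>n\<^sub>i n\<^sub>j.
        i \<noteq> j \<longrightarrow> facet_normal C' i n\<^sub>i \<longrightarrow> facet_normal C' j n\<^sub>j \<longrightarrow> \<delta> \<le> norm (n\<^sub>i - n\<^sub>j)))"

lemma edge_wide_doubleton:
  fixes a b :: "'a::euclidean_space"
  assumes "a \<noteq> b"
  shows "edge_wide 1 {a, b}"
  unfolding edge_wide_def
proof
  fix u assume "u \<in> direction_space {a, b}"
  then have "u \<in> span {a - b}"
    using direction_space_eq_span[of b "{a, b}"] by (simp add: span_insert_0 insert_commute)
  then obtain t where "u = t *\<^sub>R (a - b)"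
    by (auto simp: span_singleton)
  then have "1 * norm u * norm (a - b) \<le> \<bar>u \<bullet> (a - b)\<bar>"
    by (simp add: abs_mult power2_norm_eq_inner[symmetric] power2_eq_square)
  then show "\<exists>x\<in>{a, b}. \<exists>y\<in>{a, b}. x \<noteq> y \<and> 1 * norm u * norm (x - y) \<le> \<bar>u \<bullet> (x - y)\<bar>"
    using assms by blast
qed

text \<open>For \<open>t \<ge> 0\<close> the vector \<open>t *\<^sub>R n\<close> has length
  \<open>t\<close>, so its distance \<open>\<bar>t - 1\<bar>\<close> from \<open>n\<close> is at
  most its distance from the unit vector \<open>u\<close>, by the reverse triangle inequality. Hence
  the factor 2.\<close>

lemma unit_normal_near:
  fixes u n :: "'a::real_inner"
  assumes "norm u = 1" "norm n = 1" "norm (u - t *\<^sub>R n) < \<eta>" "t \<ge> 0"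
  shows "norm (u - n) < 2 * \<eta>"
proof -
  have "norm (u - n) \<le> norm (u - t *\<^sub>R n) + norm (t *\<^sub>R n - n)"
    using norm_triangle_ineq[of "u - t *\<^sub>R n" "t *\<^sub>R n - n"] by simp
  also have "norm (t *\<^sub>R n - n) = \<bar>t - 1\<bar>"
    using assms(2) by (metis mult.right_neutral norm_scaleR scaleR_left_diff_distrib scaleR_one)
  also have "\<bar>t - 1\<bar> \<le> norm (u - t *\<^sub>R n)"
    using norm_triangle_ineq3[of u "t *\<^sub>R n"] assms(1,2,4) by simp
  finally show ?thesis using assms(3) by simp
qed

text \<open>If a unit vector \<open>u\<close> were nearly orthogonal to all edges, then so would be its projections to
  the facets; by induction these are short, so all facet normals are close to \<open>u\<close> or \<open>- u\<close>.
  Two of the at least three normals are then close to each other.\<close>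

lemma edge_wide_step:
  fixes C :: "'a::euclidean_space set"
  assumes C: "\<not> affine_dependent C" "card C \<ge> 3"
    and m: "m > 0" and \<delta>: "\<delta> > 0"
    and sep: "normals_separated \<delta> C"
    and facets: "\<And>c. c \<in> C \<Longrightarrow> edge_wide m (C - {c})"
  shows "edge_wide (m * \<delta> / 4) C"
proof (rule ccontr)
  \<comment> \<open>Chosen backwards: projections to facets become shorter than
    \<open>\<epsilon> / m = \<delta> / 4\<close>, passing to unit normals doubles this to
    \<open>\<delta> / 2\<close>, and two such normals are closer than
    \<open>\<delta>\<close>.\<close>
  define \<epsilon> where "\<epsilon> = m * \<delta> / 4"
  assume "\<not> edge_wide (m * \<delta> / 4) C"
  then obtain u0 where u0: "u0 \<in> direction_space C"
    and thin0: "\<And>a b. a \<in> C \<Longrightarrow> b \<in> C \<Longrightarrow> a \<noteq> b \<Longrightarrow> \<bar>u0 \<bullet> (a - b)\<bar> < \<epsilon> * norm u0 * norm (a - b)"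
    unfolding edge_wide_def \<epsilon>_def by (meson not_le)
  obtain c1 c2 c3 where c: "c1 \<in> C" "c2 \<in> C" "c3 \<in> C" "c1 \<noteq> c2" "c1 \<noteq> c3" "c2 \<noteq> c3"
  proof -
    obtain T where "T \<subseteq> C" "card T = 3"
      using C(2) by (meson obtain_subset_with_card_n)
    then show ?thesis
      using that by (auto simp: card_3_iff)
  qed
  have "u0 \<noteq> 0"
    using thin0[OF c(1,2,4)] by auto
  define u where "u = u0 /\<^sub>R norm u0"
  have u: "norm u = 1"
    using \<open>u0 \<noteq> 0\<close> by (simp add: u_def)
  have sub: "subspace (direction_space C)"
    using subspace_direction_space c(1) by blast
  have uC: "u \<in> direction_space C"
    using u0 sub by (simp add: u_def subspace_scale)
  have thin: "\<bar>u \<bullet> (a - b)\<bar> < \<epsilon> * norm (a - b)" if "a \<in> C" "b \<in> C" "a \<noteq> b" for a b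
    using thin0[OF that] \<open>u0 \<noteq> 0\<close> by (simp add: u_def abs_mult field_simps)
  have near: "\<exists>n. facet_normal C c n \<and> norm (u - (u \<bullet> n) *\<^sub>R n) < \<delta> / 4" if cC: "c \<in> C" for c
  proof -
    obtain x0 where x0: "x0 \<in> C - {c}"
      using c cC by blast
    obtain n where n: "facet_normal C c n"
      using facet_normal_exists[OF C(1) cC x0] by blast
    define v where "v = u - (u \<bullet> n) *\<^sub>R n"
    have "v \<in> direction_space (C - {c})"
      unfolding v_def by (rule facet_normal_project[OF n cC x0 uC])
    then obtain a b where ab: "a \<in> C - {c}" "b \<in> C - {c}" "a \<noteq> b" "m * norm v * norm (a - b) \<le> \<bar>v \<bullet> (a - b)\<bar>"
      using facets[OF cC] unfolding edge_wide_def by blast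
    have "n \<bullet> (a - b) = 0"
      using n ab unfolding facet_normal_def by blast
    then have "v \<bullet> (a - b) = u \<bullet> (a - b)"
      by (simp add: v_def inner_diff_left)
    then have "\<bar>v \<bullet> (a - b)\<bar> < \<epsilon> * norm (a - b)"
      using thin[of a b] ab by simp
    with ab(4) have "m * norm v * norm (a - b) < \<epsilon> * norm (a - b)"
      by linarith
    then have "m * norm v < \<epsilon>"
      using ab(3) by simp
    then have "norm v < \<delta> / 4"
      using m by (simp add: \<epsilon>_def)
    then show ?thesis using n v_def by blast
  qed
  obtain n1 where n1: "facet_normal C c1 n1" "norm (u - (u \<bullet> n1) *\<^sub>R n1) < \<delta> / 4"
    using near[OF c(1)] by blast
  obtain n2 where n2: "facet_normal C c2 n2" "norm (u - (u \<bullet> n2) *\<^sub>R n2) < \<delta> / 4"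
    using near[OF c(2)] by blast
  obtain n3 where n3: "facet_normal C c3 n3" "norm (u - (u \<bullet> n3) *\<^sub>R n3) < \<delta> / 4"
    using near[OF c(3)] by blast
  have far: "\<delta> \<le> norm (x - y)"
    if "i \<in> C" "j \<in> C" "i \<noteq> j" "facet_normal C i x" "facet_normal C j y" for i j x y
    using sep C(2) that unfolding normals_separated_def by blast
  have close: "norm (x - y) < \<delta>"
    if prem: "facet_normal C i x" "facet_normal C j y"
      "norm (u - (u \<bullet> x) *\<^sub>R x) < \<delta> / 4" "norm (u - (u \<bullet> y) *\<^sub>R y) < \<delta> / 4"
      "0 \<le> (u \<bullet> x) * (u \<bullet> y)" for i j x y
  proof -
    have xy: "norm x = 1" "norm y = 1"
      using prem by (auto simp: facet_normal_def)
    \<comment> \<open>\<open>s\<close> is \<open>u\<close> or \<open>- u\<close>, whichever has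
      nonnegative products with both normals; distances to the lines of \<open>x\<close> and
      \<open>y\<close> do not depend on the sign.\<close>
    obtain s where s: "norm s = 1" "norm (s - (s \<bullet> x) *\<^sub>R x) < \<delta> / 4" "norm (s - (s \<bullet> y) *\<^sub>R y) < \<delta> / 4"
      "s \<bullet> x \<ge> 0" "s \<bullet> y \<ge> 0"
    proof (cases "u \<bullet> x \<ge> 0 \<and> u \<bullet> y \<ge> 0")
      case True
      then show ?thesis using prem(3,4) u by (intro that) auto
    next
      case False
      then have le: "u \<bullet> x \<le> 0" "u \<bullet> y \<le> 0"
        using prem(5) by (auto simp: zero_le_mult_iff)
      have "norm (- u - (- u \<bullet> z) *\<^sub>R z) = norm (u - (u \<bullet> z) *\<^sub>R z)" for z
        using norm_minus_cancel[of "u - (u \<bullet> z) *\<^sub>R z"] by (simp add: algebra_simps)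
      then show ?thesis
        using prem(3,4) u le by (intro that[of "- u"]) auto
    qed
    have "norm (s - x) < 2 * (\<delta> / 4)" "norm (s - y) < 2 * (\<delta> / 4)"
      using unit_normal_near[OF s(1) xy(1) s(2,4)] unit_normal_near[OF s(1) xy(2) s(3,5)] by auto
    then show ?thesis
      using norm_triangle_ineq4[of "s - y" "s - x"] by simp
  qed
  \<comment> \<open>Pigeonhole: among three reals, two do not have opposite signs.\<close>
  have "0 \<le> (u \<bullet> n1) * (u \<bullet> n2) \<or> 0 \<le> (u \<bullet> n1) * (u \<bullet> n3) \<or> 0 \<le> (u \<bullet> n2) * (u \<bullet> n3)"
    by (auto simp: zero_le_mult_iff)
  then show False
    using close[OF n1(1) n2(1) n1(2) n2(2)] close[OF n1(1) n3(1) n1(2) n3(2)]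
      close[OF n2(1) n3(1) n2(2) n3(2)] far[OF c(1,2,4) n1(1) n2(1)]
      far[OF c(1,3,5) n1(1) n3(1)] far[OF c(2,3,6) n2(1) n3(1)] by linarith
qed

text \<open>Induction on the number of vertices, starting from a single edge with constant 1. Each
  further vertex multiplies the constant by \<open>\<delta> / 4\<close>, so \<open>m\<close> depends
  on \<open>\<delta>\<close> and \<open>k\<close> only.\<close>

lemma normals_separated_imp_edge_wide:
  assumes \<delta>: "\<delta> > 0" and k: "k \<ge> 2"
  shows "\<exists>m>0. \<forall>C::'a::euclidean_space set.
    \<not> affine_dependent C \<longrightarrow> card C = k \<longrightarrow> normals_separated \<delta> C \<longrightarrow> edge_wide m C"
  using k
proof (induction k rule: dec_induct)
  case base
  then show ?case
    using edge_wide_doubleton by (intro exI[of _ 1]) (auto simp: card_2_iff)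
next
  case (step k)
  then obtain m where m: "m > 0" and IH: "\<And>C::'a set.
    \<not> affine_dependent C \<Longrightarrow> card C = k \<Longrightarrow> normals_separated \<delta> C \<Longrightarrow> edge_wide m C"
    by blast
  have "edge_wide (m * \<delta> / 4) C"
    if C: "\<not> affine_dependent C" "card C = Suc k" "normals_separated \<delta> C" for C :: "'a set"
  proof (rule edge_wide_step[OF C(1) _ m \<delta> C(3)])
    show "3 \<le> card C" using step C(2) by simp
    fix c assume "c \<in> C"
    show "edge_wide m (C - {c})"
    proof (rule IH)
      show "\<not> affine_dependent (C - {c})"
        using affine_independent_subset[OF C(1)] by blast
      show "card (C - {c}) = k"
        using \<open>c \<in> C\<close> C(2) by (simp add: card_Diff_singleton)
      show "normals_separated \<delta> (C - {c})"
        using C(3) unfolding normals_separated_def by blast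
    qed
  qed
  with m \<delta> show ?case
    by (intro exI[of _ "m * \<delta> / 4"]) auto
qed

section \<open>Greedy choice of \<open>d\<close> vectors from a wide set\<close>

definition wide_frame :: "real \<Rightarrow> 'a::euclidean_space set \<Rightarrow> bool" where
  "wide_frame m W \<longleftrightarrow> (\<forall>u. \<exists>w\<in>W. m * norm u * norm w \<le> \<bar>u \<bullet> w\<bar>)"

text \<open>During the selection \<open>W\<close> spans only a subspace and controls vectors only
  there. \<open>K\<close> bounds the norm by the products with \<open>W\<close>; in this form the
  empty set qualifies with \<open>K = 0\<close>.\<close>

definition frame_bound :: "real \<Rightarrow> 'a::euclidean_space set \<Rightarrow> bool" where
  "frame_bound K W \<longleftrightarrow>
     (\<forall>u\<in>span W. \<forall>\<epsilon>\<ge>0. (\<forall>w\<in>W. \<bar>u \<bullet> w\<bar> \<le> \<epsilon> * norm w) \<longrightarrow> norm u \<le> K * \<epsilon>)"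

text \<open>Split \<open>u = y + k *\<^sub>R p\<close> with \<open>y\<close> in
  \<open>span W\<close> and \<open>p\<close> the part of \<open>x\<close> orthogonal to it. On
  \<open>W\<close> the products of \<open>y\<close> are those of \<open>u\<close>, so
  \<open>norm y \<le> K * \<epsilon>\<close>; pairing with \<open>x\<close> bounds
  \<open>norm (k *\<^sub>R p) * norm p\<close> by \<open>(1 + K) * \<epsilon> * norm x\<close>. The
  direction \<open>q\<close> ensures \<open>m * norm x \<le> norm p\<close>, whence the divisor
  \<open>m\<close>.\<close>

lemma frame_bound_insert:
  fixes W :: "'a::euclidean_space set"
  assumes W: "frame_bound K W" "K \<ge> 0" and m: "m > 0"
    and q: "norm q = 1" "\<And>w. w \<in> span W \<Longrightarrow> q \<bullet> w = 0" and x: "x \<noteq> 0" "m * norm x \<le> \<bar>q \<bullet> x\<bar>"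
  shows "frame_bound (K + (1 + K) / m) (insert x W)"
  unfolding frame_bound_def
proof (intro ballI allI impI)
  fix u and \<epsilon> :: real
  assume u: "u \<in> span (insert x W)" and \<epsilon>: "\<epsilon> \<ge> 0" and le: "\<forall>w\<in>insert x W. \<bar>u \<bullet> w\<bar> \<le> \<epsilon> * norm w"
  obtain y0 p where y0: "y0 \<in> span W" and p: "\<And>w. w \<in> span W \<Longrightarrow> orthogonal p w" and xp: "x = y0 + p"
    using orthogonal_subspace_decomp_exists by blast
  obtain k where k: "u - k *\<^sub>R x \<in> span W"
    using u span_breakdown_eq by blast
  define y where "y = (u - k *\<^sub>R x) + k *\<^sub>R y0"
  have y: "y \<in> span W"
    unfolding y_def using k y0 by (intro span_add span_scale)
  have uy: "u = y + k *\<^sub>R p"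
    by (simp add: y_def xp algebra_simps)
  have pw: "p \<bullet> w = 0" if "w \<in> span W" for w
    using p[OF that] by (simp add: orthogonal_def)
  have "\<bar>y \<bullet> w\<bar> \<le> \<epsilon> * norm w" if "w \<in> W" for w
    using le that pw[OF span_base[OF that]] by (auto simp: uy inner_add_left)
  then have ny: "norm y \<le> K * \<epsilon>"
    using W(1) y \<epsilon> unfolding frame_bound_def by blast
  have "\<bar>q \<bullet> x\<bar> \<le> norm p"
    using Cauchy_Schwarz_ineq2[of q p] q(1) q(2)[OF y0] by (simp add: xp inner_add_right)
  then have mp: "m * norm x \<le> norm p"
    using x(2) by simp
  have "norm (k *\<^sub>R p) * norm p = \<bar>k *\<^sub>R p \<bullet> x\<bar>"
    using pw[OF y0] by (simp add: xp inner_add_right abs_mult power2_norm_eq_inner[symmetric] power2_eq_square)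
  also have "k *\<^sub>R p \<bullet> x = u \<bullet> x - y \<bullet> x"
    by (simp add: uy inner_add_left)
  also have "\<bar>u \<bullet> x - y \<bullet> x\<bar> \<le> \<bar>u \<bullet> x\<bar> + \<bar>y \<bullet> x\<bar>"
    by simp
  also have "\<dots> \<le> \<epsilon> * norm x + K * \<epsilon> * norm x"
  proof (intro add_mono)
    show "\<bar>u \<bullet> x\<bar> \<le> \<epsilon> * norm x" using le by simp
    have "\<bar>y \<bullet> x\<bar> \<le> norm y * norm x" by (rule Cauchy_Schwarz_ineq2)
    also have "\<dots> \<le> K * \<epsilon> * norm x" using ny by (intro mult_right_mono) auto
    finally show "\<bar>y \<bullet> x\<bar> \<le> K * \<epsilon> * norm x" .
  qed
  finally have "norm (k *\<^sub>R p) * norm p \<le> (1 + K) * \<epsilon> * norm x"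
    by (simp add: algebra_simps)
  moreover have "norm (k *\<^sub>R p) * (m * norm x) \<le> norm (k *\<^sub>R p) * norm p"
    using mp by (intro mult_left_mono) auto
  ultimately have "(norm (k *\<^sub>R p) * m) * norm x \<le> (1 + K) * \<epsilon> * norm x"
    by (simp add: mult.assoc)
  then have "norm (k *\<^sub>R p) * m \<le> (1 + K) * \<epsilon>"
    using x(1) by (auto dest: mult_right_le_imp_le)
  then have "norm (k *\<^sub>R p) \<le> (1 + K) / m * \<epsilon>"
    using m by (simp add: field_simps)
  moreover have "norm u \<le> norm y + norm (k *\<^sub>R p)"
    unfolding uy by (rule norm_triangle_ineq)
  ultimately show "norm u \<le> (K + (1 + K) / m) * \<epsilon>"
    using ny by (simp add: algebra_simps)
qed

text \<open>While fewer than \<open>d\<close> vectors are chosen, some unit \<open>q\<close> is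
  orthogonal to all of them. Wideness of \<open>X\<close> in the direction \<open>q\<close> supplies
  a vector that is not merely outside their span but at a definite angle to it.\<close>

lemma frame_bound_choice:
  assumes m: "m > 0" and k: "k \<le> DIM('a::euclidean_space)"
  shows "\<exists>K\<ge>0. \<forall>X::'a set. (\<forall>x\<in>X. x \<noteq> 0) \<longrightarrow> wide_frame m X \<longrightarrow>
    (\<exists>W\<subseteq>X. card W = k \<and> independent W \<and> frame_bound K W)"
  using k
proof (induction k)
  case 0
  have "frame_bound 0 ({} :: 'a set)"
    by (simp add: frame_bound_def)
  then show ?case
    by (intro exI[of _ 0]) (auto intro!: exI[of _ "{}"] independent_empty)
next
  case (Suc k)
  then obtain K where K: "K \<ge> 0" and IH: "\<And>X::'a set. (\<forall>x\<in>X. x \<noteq> 0) \<Longrightarrow> wide_frame m X \<Longrightarrow>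
    (\<exists>W\<subseteq>X. card W = k \<and> independent W \<and> frame_bound K W)"
    by auto
  have "\<exists>W\<subseteq>X. card W = Suc k \<and> independent W \<and> frame_bound (K + (1 + K) / m) W"
    if X: "\<forall>x\<in>X. x \<noteq> 0" "wide_frame m X" for X :: "'a set"
  proof -
    obtain W where W: "W \<subseteq> X" "card W = k" "independent W" "frame_bound K W"
      using IH[OF X] by blast
    have "dim W < DIM('a)"
      using W Suc.prems by (simp add: dim_eq_card_independent)
    then have "span W \<noteq> UNIV"
      using dim_eq_full[of W] by simp
    then obtain q0 where q0: "q0 \<noteq> 0" "\<And>w. w \<in> span W \<Longrightarrow> q0 \<bullet> w = 0"
      using span_not_UNIV_orthogonal[of W] by (metis inner_commute)
    define q where "q = q0 /\<^sub>R norm q0"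
    have q: "norm q = 1" "\<And>w. w \<in> span W \<Longrightarrow> q \<bullet> w = 0"
      using q0 by (auto simp: q_def)
    obtain x where x: "x \<in> X" "m * norm x \<le> \<bar>q \<bullet> x\<bar>"
      using X(2) q(1) unfolding wide_frame_def by (metis mult.right_neutral)
    have x0: "x \<noteq> 0"
      using X(1) x(1) by blast
    have "x \<notin> span W"
    proof
      assume "x \<in> span W"
      then have "m * norm x \<le> 0"
        using x(2) q(2) by simp
      moreover have "m * norm x > 0"
        using m x0 by simp
      ultimately show False by simp
    qed
    moreover from this have "x \<notin> W"
      using span_base by blast
    ultimately have "card (insert x W) = Suc k" "independent (insert x W)"
      using W independent_imp_finite[OF W(3)] by (auto simp: independent_insert)
    then show ?thesis
      using frame_bound_insert[OF W(4) K m q x0 x(2)] W(1) x(1) by (intro exI[of _ "insert x W"]) auto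
  qed
  with K m show ?case
    by (intro exI[of _ "K + (1 + K) / m"]) auto
qed

lemma wide_frame_choice:
  assumes m: "m > 0"
  shows "\<exists>m'>0. \<forall>X::'a::euclidean_space set. (\<forall>x\<in>X. x \<noteq> 0) \<longrightarrow> wide_frame m X \<longrightarrow>
    (\<exists>W\<subseteq>X. card W = DIM('a) \<and> independent W \<and> wide_frame m' W)"
proof -
  obtain K where K: "K \<ge> 0" and choice: "\<And>X::'a set. (\<forall>x\<in>X. x \<noteq> 0) \<Longrightarrow> wide_frame m X \<Longrightarrow>
    (\<exists>W\<subseteq>X. card W = DIM('a) \<and> independent W \<and> frame_bound K W)"
    using frame_bound_choice[OF m order_refl] by blast
  \<comment> \<open>If all products were below \<open>norm u / (K + 1)\<close> times
    \<open>norm w\<close>, the frame bound would give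
    \<open>norm u \<le> K / (K + 1) * norm u\<close>, so \<open>u = 0\<close>, against the strict
    inequalities. The \<open>+ 1\<close> makes the factor smaller than 1 and covers
    \<open>K = 0\<close>.\<close>
  have "wide_frame (1 / (K + 1)) W" if W: "card W = DIM('a)" "independent W" "frame_bound K W" for W :: "'a set"
    unfolding wide_frame_def
  proof (rule allI, rule ccontr)
    fix u assume "\<not> (\<exists>w\<in>W. 1 / (K + 1) * norm u * norm w \<le> \<bar>u \<bullet> w\<bar>)"
    then have lt: "\<bar>u \<bullet> w\<bar> < 1 / (K + 1) * norm u * norm w" if "w \<in> W" for w
      using that by (meson not_le)
    have "span W = UNIV"
      using W dim_eq_full[of W] by (simp add: dim_eq_card_independent)
    moreover have "0 \<le> 1 / (K + 1) * norm u"
      using K by simp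
    ultimately have "norm u \<le> K * (1 / (K + 1) * norm u)"
      using W(3) lt less_imp_le unfolding frame_bound_def by blast
    then have "norm u \<le> 0"
      using K by (simp add: field_simps)
    moreover have "W \<noteq> {}"
      using W(1) by auto
    ultimately show False
      using lt by auto
  qed
  with K choice show ?thesis
    by (intro exI[of _ "1 / (K + 1)"]) (smt (verit, best) divide_pos_pos)
qed

section \<open>Jamet's condition and dihedral angles\<close>

lemma full_simplexE:
  fixes S :: "'a::euclidean_space set"
  assumes "int DIM('a) simplex S"
  obtains C where "\<not> affine_dependent C" "card C = Suc DIM('a)" "S = convex hull C"
    "direction_space C = UNIV"
proof -
  obtain C where C: "\<not> affine_dependent C" "int (card C) = int DIM('a) + 1" "S = convex hull C"
    using assms by (auto simp: simplex_def)
  have "aff_dim C = int DIM('a)"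
    using C by (simp add: aff_dim_affine_independent)
  then have "affine hull C = UNIV"
    using affine_hull_UNIV[of C] by simp
  then have "direction_space C = UNIV"
  proof -
    have "z \<in> {x - y | x y. x \<in> UNIV \<and> y \<in> UNIV}" for z :: 'a
      by (rule CollectI, rule exI[of _ z], rule exI[of _ 0]) simp
    then show ?thesis
      unfolding direction_space_def \<open>affine hull C = UNIV\<close> by blast
  qed
  moreover have "card C = Suc DIM('a)"
    using C(2) by simp
  ultimately show ?thesis
    using C(1,3) that by blast
qed

lemma edge_vectors_simplex:
  fixes C :: "'a::euclidean_space set"
  assumes C: "\<not> affine_dependent C"
  shows "edge_vectors (convex hull C) = {a - b | a b. a \<in> C \<and> b \<in> C \<and> a \<noteq> b}"
proof -
  have edge: "closed_segment a b edge_of (convex hull C) \<longleftrightarrow> a \<in> C \<and> b \<in> C \<and> a \<noteq> b" for a b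
  proof
    assume e: "closed_segment a b edge_of (convex hull C)"
    then have f: "closed_segment a b face_of (convex hull C)"
      by (simp add: edge_of_def)
    have "a \<noteq> b"
      using e by (auto simp: edge_of_def)
    then show "a \<in> C \<and> b \<in> C \<and> a \<noteq> b"
      using segment_face_of[OF f] by (simp add: extreme_point_of_convex_hull_affine_independent[OF C])
  next
    assume ab: "a \<in> C \<and> b \<in> C \<and> a \<noteq> b"
    have "convex hull {a, b} face_of (convex hull C)"
      unfolding face_of_convex_hull_affine_independent[OF C] using ab by (intro exI[of _ "{a, b}"]) simp
    moreover have "aff_dim (convex hull {a, b}) = 1"
      using ab by (simp add: aff_dim_convex_hull aff_dim_2)
    ultimately show "closed_segment a b edge_of (convex hull C)"
      by (simp add: edge_of_def segment_convex_hull)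
  qed
  show ?thesis
    unfolding edge_vectors_def edge by blast
qed

lemma wide_frame_edge_vectors_iff:
  assumes "\<not> affine_dependent C" "direction_space C = UNIV"
  shows "wide_frame m (edge_vectors (convex hull C)) \<longleftrightarrow> edge_wide m C"
  unfolding wide_frame_def edge_wide_def edge_vectors_simplex[OF assms(1)] assms(2) by blast

lemma edge_vectors_nonzero:
  assumes "int DIM('a) simplex (S :: 'a::euclidean_space set)" "w \<in> edge_vectors S"
  shows "w \<noteq> 0"
proof -
  obtain C where "\<not> affine_dependent C" "S = convex hull C"
    using full_simplexE[OF assms(1)] by blast
  then show ?thesis
    using assms(2) by (auto simp: edge_vectors_simplex)
qed

definition uniformly_wide :: "'a::euclidean_space set set set \<Rightarrow> bool" where
  "uniformly_wide \<F> \<longleftrightarrow> (\<exists>m>0. \<forall>T\<in>\<F>. \<forall>S\<in>T. wide_frame m (edge_vectors S))"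

text \<open>One selection serves both Jamet's condition and the \<open>d\<close>-sine. It is uniform
  over the family because \<open>wide_frame_choice\<close> fixes its constant before the set of
  vectors.\<close>

lemma uniformly_wide_choice:
  fixes \<F> :: "'a::euclidean_space set set set"
  assumes simplices: "\<And>T S. T \<in> \<F> \<Longrightarrow> S \<in> T \<Longrightarrow> int DIM('a) simplex S"
    and wide: "uniformly_wide \<F>"
  shows "\<exists>m>0. \<forall>T\<in>\<F>. \<forall>S\<in>T.
    \<exists>W\<subseteq>edge_vectors S. card W = DIM('a) \<and> independent W \<and> wide_frame m W"
proof -
  obtain m0 where "m0 > 0" and m0: "\<And>T S. T \<in> \<F> \<Longrightarrow> S \<in> T \<Longrightarrow> wide_frame m0 (edge_vectors S)"
    using wide unfolding uniformly_wide_def by blast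
  then obtain m where m: "m > 0" and choice: "\<And>X::'a set. \<forall>x\<in>X. x \<noteq> 0 \<Longrightarrow> wide_frame m0 X \<Longrightarrow>
      \<exists>W\<subseteq>X. card W = DIM('a) \<and> independent W \<and> wide_frame m W"
    using wide_frame_choice[OF \<open>m0 > 0\<close>, where 'a = 'a] by blast
  show ?thesis
  proof (intro exI[of _ m] conjI ballI)
    show "m > 0" by (rule m)
    fix T S assume TS: "T \<in> \<F>" "S \<in> T"
    show "\<exists>W\<subseteq>edge_vectors S. card W = DIM('a) \<and> independent W \<and> wide_frame m W"
      using choice[of "edge_vectors S"] m0[OF TS] edge_vectors_nonzero[OF simplices[OF TS]] by blast
  qed
qed

section \<open>Jamet's angle as a bound on cosines\<close>

lemma line_angle_le_pi: "line_angle u e \<le> pi" and line_angle_nonneg: "0 \<le> line_angle u e"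
  and cos_line_angle: "cos (line_angle u e) = \<bar>u \<bullet> e\<bar> / (norm u * norm e)"
proof -
  have "\<bar>u \<bullet> e\<bar> / (norm u * norm e) \<le> 1"
    using Cauchy_Schwarz_ineq2[of u e] by (cases "u = 0 \<or> e = 0") auto
  moreover have "0 \<le> \<bar>u \<bullet> e\<bar> / (norm u * norm e)"
    by simp
  ultimately have "-1 \<le> \<bar>u \<bullet> e\<bar> / (norm u * norm e)" "\<bar>u \<bullet> e\<bar> / (norm u * norm e) \<le> 1"
    by linarith+
  then show "line_angle u e \<le> pi" "0 \<le> line_angle u e"
    "cos (line_angle u e) = \<bar>u \<bullet> e\<bar> / (norm u * norm e)"
    unfolding line_angle_def by (auto intro: arccos_ubound arccos_lbound cos_arccos)
qed

text \<open>A real \<open>SUP\<close> is known to dominate its members only when these are bounded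
  above; \<open>pi\<close> serves as a bound. The minimum over the finite nonempty \<open>E\<close>
  is attained.\<close>

lemma jamet_angle_attained:
  fixes u :: "'a::euclidean_space"
  assumes E: "finite E" "E \<noteq> {}" and u: "norm u = 1"
  shows "\<exists>e\<in>E. line_angle u e \<le> jamet_angle E"
proof -
  have "bdd_above ((\<lambda>u. MIN e\<in>E. line_angle u e) ` sphere 0 1)"
  proof (rule bdd_aboveI2)
    fix v :: 'a
    show "(MIN e\<in>E. line_angle v e) \<le> pi"
      using E line_angle_le_pi by (subst Min_le_iff) auto
  qed
  then have "(MIN e\<in>E. line_angle u e) \<le> jamet_angle E"
    unfolding jamet_angle_def using u by (intro cSUP_upper) auto
  then show ?thesis
    using E by (subst (asm) Min_le_iff) auto
qed

lemma jamet_condition_imp_uniformly_wide: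
  fixes \<F> :: "'a::euclidean_space set set set"
  assumes simplices: "\<And>T S. T \<in> \<F> \<Longrightarrow> S \<in> T \<Longrightarrow> int DIM('a) simplex S"
    and jamet: "jamet_condition \<F>"
  shows "uniformly_wide \<F>"
proof -
  obtain \<theta>\<^sub>0 where \<theta>\<^sub>0: "\<theta>\<^sub>0 < pi / 2" and E: "\<And>T S. T \<in> \<F> \<Longrightarrow> S \<in> T \<Longrightarrow>
      \<exists>E \<subseteq> sgn ` edge_vectors S. card E = DIM('a) \<and> jamet_angle E \<le> \<theta>\<^sub>0"
    using jamet unfolding jamet_condition_def by blast
  \<comment> \<open>\<open>\<theta>\<^sub>0\<close> may be negative, while the cosine is decreasing
    only from 0 to \<open>pi\<close>; the larger value is still below \<open>pi / 2\<close>.\<close>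
  define \<theta> where "\<theta> = max \<theta>\<^sub>0 0"
  have \<theta>: "0 \<le> \<theta>" "\<theta> < pi / 2" "\<theta>\<^sub>0 \<le> \<theta>"
    using \<theta>\<^sub>0 by (auto simp: \<theta>_def max_def)
  have "wide_frame (cos \<theta>) (edge_vectors S)" if TS: "T \<in> \<F>" "S \<in> T" for T S
    unfolding wide_frame_def
  proof
    fix u :: 'a
    obtain E where E: "E \<subseteq> sgn ` edge_vectors S" "card E = DIM('a)" "jamet_angle E \<le> \<theta>\<^sub>0"
      using E[OF TS] by blast
    have fE: "finite E" "E \<noteq> {}"
      using E(2) by (metis DIM_positive card.infinite less_irrefl, metis DIM_positive card.empty less_irrefl)
    show "\<exists>w\<in>edge_vectors S. cos \<theta> * norm u * norm w \<le> \<bar>u \<bullet> w\<bar>"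
    proof (cases "u = 0")
      case True
      then show ?thesis using fE E(1) by auto
    next
      case False
      then obtain e where e: "e \<in> E" "line_angle (sgn u) e \<le> jamet_angle E"
        using jamet_angle_attained[OF fE, of "sgn u"] by (auto simp: norm_sgn)
      obtain w where w: "w \<in> edge_vectors S" "e = sgn w"
        using e(1) E(1) by blast
      have "w \<noteq> 0"
        by (rule edge_vectors_nonzero[OF simplices[OF TS] w(1)])
      have "line_angle (sgn u) e \<le> \<theta>"
        using e(2) E(3) \<theta>(3) by simp
      then have "cos \<theta> \<le> cos (line_angle (sgn u) e)"
        using \<theta> line_angle_nonneg by (intro cos_monotone_0_pi_le) auto
      also have "\<dots> = \<bar>u \<bullet> w\<bar> / (norm u * norm w)"
        using False \<open>w \<noteq> 0\<close> by (simp add: cos_line_angle w(2) norm_sgn sgn_div_norm abs_mult divide_inverse)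
      finally have "cos \<theta> * (norm u * norm w) \<le> \<bar>u \<bullet> w\<bar>"
        using False \<open>w \<noteq> 0\<close> by (simp add: pos_le_divide_eq)
      then show ?thesis
        using w(1) by (auto simp: mult.assoc)
    qed
  qed
  moreover have "cos \<theta> > 0"
    using \<theta> by (intro cos_gt_zero_pi) auto
  ultimately show ?thesis
    unfolding uniformly_wide_def by blast
qed

lemma uniformly_wide_imp_jamet_condition:
  fixes \<F> :: "'a::euclidean_space set set set"
  assumes simplices: "\<And>T S. T \<in> \<F> \<Longrightarrow> S \<in> T \<Longrightarrow> int DIM('a) simplex S"
    and wide: "uniformly_wide \<F>"
  shows "jamet_condition \<F>"
proof -
  have "\<exists>m>0. \<forall>T\<in>\<F>. \<forall>S\<in>T.
      \<exists>W\<subseteq>edge_vectors S. card W = DIM('a) \<and> independent W \<and> wide_frame m W"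
    by (rule uniformly_wide_choice) (fact simplices, fact wide)
  then obtain m0 where "m0 > 0" and choice: "\<forall>T\<in>\<F>. \<forall>S\<in>T.
      \<exists>W\<subseteq>edge_vectors S. card W = DIM('a) \<and> independent W \<and> wide_frame m0 W"
    by (elim exE conjE)
  \<comment> \<open>The cap at 1 keeps \<open>m\<close> in the domain of
    \<open>arccos\<close>.\<close>
  define m where "m = min m0 1"
  have m: "0 < m" "m \<le> 1" "m \<le> m0"
    using \<open>m0 > 0\<close> by (auto simp: m_def)
  have "\<exists>E\<subseteq>sgn ` edge_vectors S. card E = DIM('a) \<and> jamet_angle E \<le> arccos m"
    if TS: "T \<in> \<F>" "S \<in> T" for T S
  proof -
    obtain W where W: "W \<subseteq> edge_vectors S" "card W = DIM('a)" "independent W" "wide_frame m0 W"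
      using bspec[OF bspec[OF choice TS(1)] TS(2)] by (elim exE conjE)
    have fW: "finite W"
      using W(3) by (rule independent_imp_finite)
    \<comment> \<open>Normalizing cannot merge two chosen vectors: the unit vectors still span
      \<open>W\<close>, so there are at least \<open>dim W\<close> of them.\<close>
    have "W \<subseteq> span (sgn ` W)"
    proof
      fix w assume "w \<in> W"
      then have "norm w *\<^sub>R sgn w \<in> span (sgn ` W)"
        by (intro span_scale span_base imageI)
      then show "w \<in> span (sgn ` W)"
        by (cases "w = 0") (auto simp: sgn_div_norm)
    qed
    then have "dim W \<le> card (sgn ` W)"
      using fW by (intro dim_le_card) auto
    then have card: "card (sgn ` W) = DIM('a)"
      using card_image_le[OF fW, of sgn] W(2) dim_eq_card_independent[OF W(3)] by simp
    have ne: "W \<noteq> {}"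
      using W(2) by auto
    have "jamet_angle (sgn ` W) \<le> arccos m"
      unfolding jamet_angle_def
    proof (rule cSUP_least)
      fix u :: 'a assume u: "u \<in> sphere 0 1"
      obtain w where w: "w \<in> W" "m0 * norm u * norm w \<le> \<bar>u \<bullet> w\<bar>"
        using W(4) unfolding wide_frame_def by blast
      have "w \<noteq> 0"
        using edge_vectors_nonzero[OF simplices[OF TS]] w(1) W(1) by blast
      have "m * norm w \<le> m0 * norm w"
        using m by (intro mult_right_mono) auto
      then have "m * norm w \<le> \<bar>u \<bullet> w\<bar>"
        using w(2) u by simp
      then have "m \<le> \<bar>u \<bullet> w\<bar> / norm w"
        using \<open>w \<noteq> 0\<close> by (simp add: pos_le_divide_eq)
      also have "\<dots> = cos (line_angle u (sgn w))"
        using u \<open>w \<noteq> 0\<close> by (simp add: cos_line_angle norm_sgn sgn_div_norm abs_mult divide_inverse)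
      finally have "arccos (cos (line_angle u (sgn w))) \<le> arccos m"
        using m by (intro arccos_le_arccos) auto
      then have "line_angle u (sgn w) \<le> arccos m"
        by (simp only: arccos_cos[OF line_angle_nonneg line_angle_le_pi])
      then show "(MIN e\<in>sgn ` W. line_angle u e) \<le> arccos m"
        using fW ne w(1) by (subst Min_le_iff) auto
    qed simp
    then show ?thesis
      using W(1) card by (intro exI[of _ "sgn ` W"]) auto
  qed
  moreover have "arccos m < pi / 2"
    using m arccos_less_arccos[of 0 m] by simp
  ultimately show ?thesis
    unfolding jamet_condition_def by blast
qed

text \<open>Facets correspond to vertices, distinct vertices giving distinct facets, and the
  \<open>Max\<close> ranges over a finite nonempty set as soon as there are two. Quantifying over
  normals is harmless, since each vertex has exactly one.\<close>

lemma max_dihedral_angle_simplex_le_iff: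
  fixes C :: "'a::euclidean_space set"
  assumes C: "\<not> affine_dependent C" "card C \<ge> 2"
  shows "max_dihedral_angle (convex hull C) \<le> \<gamma> \<longleftrightarrow>
    (\<forall>i\<in>C. \<forall>j\<in>C. \<forall>n\<^sub>i n\<^sub>j. i \<noteq> j \<longrightarrow> facet_normal C i n\<^sub>i \<longrightarrow> facet_normal C j n\<^sub>j \<longrightarrow>
       arccos (- (n\<^sub>i \<bullet> n\<^sub>j)) \<le> \<gamma>)"
proof -
  let ?S = "convex hull C" and ?F = "\<lambda>c. convex hull (C - {c})"
  let ?A = "{dihedral_angle ?S F G | F G. F facet_of ?S \<and> G facet_of ?S \<and> F \<noteq> G}"
  have fC: "finite C"
    using aff_independent_finite[OF C(1)] .
  have facet: "F facet_of ?S \<longleftrightarrow> (\<exists>c\<in>C. F = ?F c)" for F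
    using facet_of_convex_hull_affine_independent_alt[OF C(1)] C(2) by auto
  have F_inj: "?F i \<noteq> ?F j" if "i \<in> C" "j \<in> C" "i \<noteq> j" for i j
  proof -
    have "i \<in> ?F j"
      using that by (intro hull_inc) auto
    moreover have "i \<notin> affine hull (C - {i})"
      using C(1) that by (auto simp: affine_dependent_def)
    then have "i \<notin> ?F i"
      using convex_hull_subset_affine_hull by blast
    ultimately show ?thesis by blast
  qed
  obtain p q where pq: "p \<in> C" "q \<in> C" "p \<noteq> q"
  proof -
    obtain T where "T \<subseteq> C" "card T = 2"
      using C(2) by (meson obtain_subset_with_card_n)
    then show ?thesis
      using that by (auto simp: card_2_iff)
  qed
  have other: "\<exists>x. x \<in> C - {c}" for c
    using pq by (cases "c = p") auto
  have angle: "dihedral_angle ?S (?F i) (?F j) = arccos (- (x \<bullet> y))"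
    if "i \<in> C" "j \<in> C" "facet_normal C i x" "facet_normal C j y" for i j x y
  proof -
    obtain p' q' where "p' \<in> C - {i}" "q' \<in> C - {j}"
      using other by blast
    then show ?thesis
      using that by (simp add: dihedral_angle_def outward_unit_normal_simplex)
  qed
  let ?B = "{dihedral_angle ?S (?F i) (?F j) | i j. i \<in> C \<and> j \<in> C \<and> i \<noteq> j}"
  have A: "?A = ?B"
  proof (intro equalityI subsetI)
    fix a assume "a \<in> ?A"
    then obtain F G where FG: "a = dihedral_angle ?S F G" "F facet_of ?S" "G facet_of ?S" "F \<noteq> G"
      by blast
    obtain i where i: "i \<in> C" "F = ?F i"
      using FG(2) unfolding facet by (elim bexE)
    obtain j where j: "j \<in> C" "G = ?F j"
      using FG(3) unfolding facet by (elim bexE)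
    have "i \<noteq> j"
      using FG(4) i(2) j(2) by (elim contrapos_nn) simp
    then show "a \<in> ?B"
      unfolding FG(1) i(2) j(2) using i(1) j(1) by blast
  next
    fix a assume "a \<in> ?B"
    then obtain i j where ij: "i \<in> C" "j \<in> C" "i \<noteq> j" "a = dihedral_angle ?S (?F i) (?F j)"
      by blast
    have "?F i facet_of ?S"
      unfolding facet by (rule bexI[OF refl ij(1)])
    moreover have "?F j facet_of ?S"
      unfolding facet by (rule bexI[OF refl ij(2)])
    moreover note F_inj[OF ij(1-3)]
    ultimately show "a \<in> ?A"
      unfolding ij(4) by blast
  qed
  have "?B \<subseteq> (\<lambda>(i, j). dihedral_angle ?S (?F i) (?F j)) ` (C \<times> C)"
    by auto
  then have "finite ?B"
    by (rule finite_subset[OF _ finite_imageI[OF finite_cartesian_product[OF fC fC]]])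
  then have "finite ?A" "?A \<noteq> {}"
    unfolding A using pq by blast+
  then have "max_dihedral_angle ?S \<le> \<gamma> \<longleftrightarrow> (\<forall>a\<in>?A. a \<le> \<gamma>)"
    unfolding max_dihedral_angle_def by (rule Max_le_iff)
  also have "\<dots> \<longleftrightarrow> (\<forall>i\<in>C. \<forall>j\<in>C. i \<noteq> j \<longrightarrow> dihedral_angle ?S (?F i) (?F j) \<le> \<gamma>)"
    unfolding A by blast
  also have "\<dots> \<longleftrightarrow> (\<forall>i\<in>C. \<forall>j\<in>C. \<forall>n\<^sub>i n\<^sub>j. i \<noteq> j \<longrightarrow> facet_normal C i n\<^sub>i \<longrightarrow> facet_normal C j n\<^sub>j \<longrightarrow>
       arccos (- (n\<^sub>i \<bullet> n\<^sub>j)) \<le> \<gamma>)"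
  proof (intro ball_cong refl iffI allI impI)
    fix i j x y
    assume "i \<in> C" "j \<in> C" "i \<noteq> j \<longrightarrow> dihedral_angle ?S (?F i) (?F j) \<le> \<gamma>" "i \<noteq> j"
      "facet_normal C i x" "facet_normal C j y"
    then show "arccos (- (x \<bullet> y)) \<le> \<gamma>"
      using angle by metis
  next
    fix i j
    assume *: "i \<in> C" "j \<in> C" "i \<noteq> j"
      "\<forall>n\<^sub>i n\<^sub>j. i \<noteq> j \<longrightarrow> facet_normal C i n\<^sub>i \<longrightarrow> facet_normal C j n\<^sub>j \<longrightarrow> arccos (- (n\<^sub>i \<bullet> n\<^sub>j)) \<le> \<gamma>"
    obtain x where x: "facet_normal C i x"
      using facet_normal_exists[OF C(1) *(1)] other[of i] by blast
    obtain y where y: "facet_normal C j y"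
      using facet_normal_exists[OF C(1) *(2)] other[of j] by blast
    show "dihedral_angle ?S (?F i) (?F j) \<le> \<gamma>"
      using * x y angle[OF *(1,2) x y] by metis
  qed
  finally show ?thesis .
qed

section \<open>Dihedral angles and wide edges\<close>

lemma norm_diff_unit:
  fixes x y :: "'a::real_inner"
  assumes "norm x = 1" "norm y = 1"
  shows "(norm (x - y))\<^sup>2 = 2 - 2 * (x \<bullet> y)"
  using assms by (simp add: power2_norm_eq_inner inner_diff_left inner_diff_right inner_commute norm_eq_1)

lemma uniformly_wide_imp_maximum_angle_condition:
  fixes \<F> :: "'a::euclidean_space set set set"
  assumes simplices: "\<And>T S. T \<in> \<F> \<Longrightarrow> S \<in> T \<Longrightarrow> int DIM('a) simplex S"
    and wide: "uniformly_wide \<F>"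
  shows "maximum_angle_condition \<F>"
proof -
  obtain m0 where "m0 > 0" and m0: "\<And>T S. T \<in> \<F> \<Longrightarrow> S \<in> T \<Longrightarrow> wide_frame m0 (edge_vectors S)"
    using wide unfolding uniformly_wide_def by blast
  \<comment> \<open>At most \<open>Suc d\<close> vertices are dropped to reach a face, so this power
    of 2 covers all faces at once.\<close>
  define m where "m = min 1 (m0 / 2 ^ Suc DIM('a))"
  have m: "0 < m" "m \<le> 1" "m \<le> m0 / 2 ^ Suc DIM('a)"
    using \<open>m0 > 0\<close> by (auto simp: m_def)
  \<comment> \<open>Normals at distance at least \<open>m\<close> have
    \<open>2 - 2 * (x \<bullet> y) \<ge> m ^ 2\<close>, so the cosine of the dihedral angle is at
    least \<open>m ^ 2 / 2 - 1\<close>, which exceeds -1.\<close>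
  define \<gamma>\<^sub>0 where "\<gamma>\<^sub>0 = arccos (m\<^sup>2 / 2 - 1)"
  have m2: "0 < m\<^sup>2" "m\<^sup>2 \<le> 1"
    using m by (simp_all add: power_le_one)
  have "\<gamma>\<^sub>0 < pi"
    unfolding \<gamma>\<^sub>0_def using arccos_less_arccos[of "-1" "m\<^sup>2 / 2 - 1"] m2 by simp
  moreover have "max_dihedral_angle S' \<le> \<gamma>\<^sub>0"
    if TS: "T \<in> \<F>" "S \<in> T" and k: "k \<ge> 2" "k simplex S'" "vertices S' \<subseteq> vertices S" for T S k S'
  proof -
    obtain C where C: "\<not> affine_dependent C" "card C = Suc DIM('a)" "S = convex hull C"
      "direction_space C = UNIV"
      using full_simplexE[OF simplices[OF TS]] by blast
    obtain C' where C': "\<not> affine_dependent C'" "int (card C') = k + 1" "S' = convex hull C'"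
      using k(2) by (auto simp: simplex_def)
    have sub: "C' \<subseteq> C"
      using k(3) extreme_point_of_convex_hull_affine_independent C C' by (auto simp: vertices_def)
    have card: "card C' \<ge> 2"
      using C'(2) k(1) by simp
    have "edge_wide m0 C"
      using m0[OF TS] C wide_frame_edge_vectors_iff by blast
    then have "edge_wide (m0 / 2 ^ (card C - card C')) C'"
      by (rule edge_wide_face[OF C(1) sub card \<open>m0 > 0\<close>])
    moreover have "m \<le> m0 / 2 ^ (card C - card C')"
    proof -
      have "m0 / 2 ^ Suc DIM('a) \<le> m0 / 2 ^ (card C - card C')"
        using \<open>m0 > 0\<close> C(2) by (intro divide_left_mono power_increasing) auto
      with m(3) show ?thesis by simp
    qed
    ultimately have wide': "edge_wide m C'"
      by (rule edge_wide_mono)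
    show ?thesis
      unfolding C'(3) max_dihedral_angle_simplex_le_iff[OF C'(1) card]
    proof (intro ballI allI impI)
      fix i j x y
      assume ij: "i \<in> C'" "j \<in> C'" "i \<noteq> j" "facet_normal C' i x" "facet_normal C' j y"
      then have xy: "norm x = 1" "norm y = 1"
        by (auto simp: facet_normal_def)
      have "m \<le> norm (x - y)"
        by (rule edge_wide_imp_normals_apart[OF wide' m(1) ij])
      then have "m\<^sup>2 \<le> (norm (x - y))\<^sup>2"
        using m(1) by (intro power_mono) auto
      then have "m\<^sup>2 / 2 - 1 \<le> - (x \<bullet> y)"
        by (simp add: norm_diff_unit[OF xy])
      moreover have "\<bar>x \<bullet> y\<bar> \<le> 1"
        using Cauchy_Schwarz_ineq2[of x y] xy by simp
      ultimately show "arccos (- (x \<bullet> y)) \<le> \<gamma>\<^sub>0"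
        unfolding \<gamma>\<^sub>0_def using m2 by (intro arccos_le_arccos) auto
    qed
  qed
  ultimately show ?thesis
    unfolding maximum_angle_condition_def by blast
qed

lemma maximum_angle_condition_imp_uniformly_wide:
  fixes \<F> :: "'a::euclidean_space set set set"
  assumes simplices: "\<And>T S. T \<in> \<F> \<Longrightarrow> S \<in> T \<Longrightarrow> int DIM('a) simplex S"
    and mac: "maximum_angle_condition \<F>"
  shows "uniformly_wide \<F>"
proof -
  obtain \<gamma>\<^sub>0 where "\<gamma>\<^sub>0 < pi" and \<gamma>\<^sub>0: "\<forall>T\<in>\<F>. \<forall>S\<in>T. \<forall>k\<ge>2. \<forall>S'.
      k simplex S' \<and> S' \<subseteq> S \<and> vertices S' \<subseteq> vertices S \<longrightarrow> max_dihedral_angle S' \<le> \<gamma>\<^sub>0"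
    using mac unfolding maximum_angle_condition_def by (elim exE conjE)
  define \<gamma> where "\<gamma> = max \<gamma>\<^sub>0 0"
  have \<gamma>: "0 \<le> \<gamma>" "\<gamma> < pi" "\<gamma>\<^sub>0 \<le> \<gamma>"
    using \<open>\<gamma>\<^sub>0 < pi\<close> by (auto simp: \<gamma>_def max_def)
  \<comment> \<open>The distance between the outward normals of two facets that meet at the angle
    \<open>\<gamma>\<close>; it is positive since \<open>\<gamma> < pi\<close>.\<close>
  define \<delta> where "\<delta> = sqrt (2 + 2 * cos \<gamma>)"
  have "cos pi < cos \<gamma>"
    using \<gamma> by (intro cos_monotone_0_pi) auto
  then have \<delta>: "\<delta> > 0"
    by (simp add: \<delta>_def)
  have "2 \<le> Suc DIM('a)"
    using DIM_positive[where 'a = 'a] by linarith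
  from normals_separated_imp_edge_wide[OF \<delta> this, where 'a = 'a]
  obtain m where m: "m > 0" and wide: "\<forall>C::'a set. \<not> affine_dependent C \<longrightarrow>
      card C = Suc DIM('a) \<longrightarrow> normals_separated \<delta> C \<longrightarrow> edge_wide m C"
    by (elim exE conjE)
  have "wide_frame m (edge_vectors S)" if TS: "T \<in> \<F>" "S \<in> T" for T S
  proof -
    obtain C where C: "\<not> affine_dependent C" "card C = Suc DIM('a)" "S = convex hull C"
      "direction_space C = UNIV"
      using full_simplexE[OF simplices[OF TS]] by blast
    have "normals_separated \<delta> C"
      unfolding normals_separated_def
    proof (intro allI impI ballI)
      fix C' i j x y
      assume C': "C' \<subseteq> C" "3 \<le> card C'"
        and ij: "i \<in> C'" "j \<in> C'" "i \<noteq> j" "facet_normal C' i x" "facet_normal C' j y"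
      have ind: "\<not> affine_dependent C'"
        using affine_independent_subset[OF C(1) C'(1)] .
      have "max_dihedral_angle (convex hull C') \<le> \<gamma>\<^sub>0"
      proof (rule \<gamma>\<^sub>0[rule_format, OF TS])
        show "2 \<le> int (card C') - 1" using C'(2) by simp
        have "(int (card C') - 1) simplex (convex hull C')"
          using ind by (auto simp: simplex_def)
        moreover have "convex hull C' \<subseteq> S"
          unfolding C(3) by (rule hull_mono[OF C'(1)])
        moreover have "vertices (convex hull C') \<subseteq> vertices S"
          using C'(1) by (auto simp: vertices_def C(3) extreme_point_of_convex_hull_affine_independent[OF C(1)]
              extreme_point_of_convex_hull_affine_independent[OF ind])
        ultimately show "(int (card C') - 1) simplex (convex hull C') \<and> convex hull C' \<subseteq> S \<and>
            vertices (convex hull C') \<subseteq> vertices S"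
          by (intro conjI)
      qed
      moreover have "2 \<le> card C'"
        using C'(2) by simp
      ultimately have "arccos (- (x \<bullet> y)) \<le> \<gamma>\<^sub>0"
        using max_dihedral_angle_simplex_le_iff[OF ind, of \<gamma>\<^sub>0] ij by blast
      then have "arccos (- (x \<bullet> y)) \<le> \<gamma>"
        using \<gamma>(3) by simp
      have xy: "norm x = 1" "norm y = 1"
        using ij by (auto simp: facet_normal_def)
      then have "\<bar>x \<bullet> y\<bar> \<le> 1"
        using Cauchy_Schwarz_ineq2[of x y] by simp
      then have bounds: "-1 \<le> - (x \<bullet> y)" "- (x \<bullet> y) \<le> 1"
        by auto
      have "cos \<gamma> \<le> cos (arccos (- (x \<bullet> y)))"
        using \<open>arccos (- (x \<bullet> y)) \<le> \<gamma>\<close> \<gamma> arccos_lbound[OF bounds] by (intro cos_monotone_0_pi_le) auto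
      then have "2 + 2 * cos \<gamma> \<le> (norm (x - y))\<^sup>2"
        using bounds by (simp add: norm_diff_unit[OF xy] cos_arccos)
      then show "\<delta> \<le> norm (x - y)"
        unfolding \<delta>_def by (intro real_le_lsqrt) auto
    qed
    then have "edge_wide m C"
      using wide C by blast
    then show ?thesis
      using C wide_frame_edge_vectors_iff by blast
  qed
  with m show ?thesis
    unfolding uniformly_wide_def by blast
qed

section \<open>Determinants and the generalized maximum angle condition\<close>

text \<open>The Leibniz formula has \<open>d!\<close> terms, each with one entry from every row.
  This crude substitute for Hadamard's inequality is enough, as constants may depend on
  \<open>d\<close>.\<close>

lemma det_bound_rows:
  fixes A :: "real^'n^'n"
  assumes "\<And>i j. \<bar>A $ i $ j\<bar> \<le> b i"
  shows "\<bar>det A\<bar> \<le> fact CARD('n) * (\<Prod>i\<in>UNIV. b i)"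
proof -
  have "\<bar>det A\<bar> \<le> (\<Sum>p | p permutes (UNIV :: 'n set). \<bar>of_int (sign p) * (\<Prod>i\<in>UNIV. A $ i $ p i)\<bar>)"
    unfolding det_def by (rule sum_abs)
  also have "\<dots> \<le> (\<Sum>p | p permutes (UNIV :: 'n set). \<Prod>i\<in>UNIV. b i)"
  proof (rule sum_mono)
    fix p :: "'n \<Rightarrow> 'n"
    have "\<bar>of_int (sign p) * (\<Prod>i\<in>UNIV. A $ i $ p i)\<bar> = (\<Prod>i\<in>UNIV. \<bar>A $ i $ p i\<bar>)"
      by (simp add: abs_mult abs_prod sign_def)
    also have "\<dots> \<le> (\<Prod>i\<in>UNIV. b i)"
      using assms by (intro prod_mono) auto
    finally show "\<bar>of_int (sign p) * (\<Prod>i\<in>UNIV. A $ i $ p i)\<bar> \<le> (\<Prod>i\<in>UNIV. b i)" .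
  qed
  also have "\<dots> = fact CARD('n) * (\<Prod>i\<in>UNIV. b i)"
    by (simp add: card_permutations)
  finally show ?thesis .
qed

text \<open>By Cramer's rule, replacing the column \<open>k\<close> of \<open>N\<close> by the image of \<open>v\<close> multiplies the
  determinant by \<open>v $ k\<close>.\<close>

lemma wide_rows_of_det:
  fixes n :: "'n::finite \<Rightarrow> real^'n"
  assumes n: "\<And>i. norm (n i) = 1" and c: "c > 0" "\<bar>det (\<chi> i. n i)\<bar> \<ge> c"
  shows "\<exists>i. c / (CARD('n) * fact CARD('n)) * norm v \<le> \<bar>v \<bullet> n i\<bar>"
proof (rule ccontr)
  \<comment> \<open>The factor \<open>1 / d!\<close> pays for the Leibniz expansion,
    \<open>1 / d\<close> for adding up the components of \<open>v\<close>.\<close>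
  define \<epsilon> where "\<epsilon> = c / (CARD('n) * fact CARD('n)) * norm v"
  assume "\<nexists>i. c / (CARD('n) * fact CARD('n)) * norm v \<le> \<bar>v \<bullet> n i\<bar>"
  then have lt: "\<bar>v \<bullet> n i\<bar> < \<epsilon>" for i
    by (simp add: \<epsilon>_def not_le)
  have "v \<noteq> 0"
    using lt[of undefined] by (auto simp: \<epsilon>_def)
  let ?N = "\<chi> i. n i"
  have comp: "\<bar>v $ k\<bar> * c < norm v * c / CARD('n)" for k
  proof -
    let ?M = "\<chi> i j. if j = k then (?N *v v) $ i else ?N $ i $ j"
    have Nv: "(?N *v v) $ i = v \<bullet> n i" for i
      by (simp add: matrix_vector_mult_def inner_vec_def mult.commute)
    \<comment> \<open>Bounding the new column by the largest product instead of
      \<open>\<epsilon>\<close> keeps the final inequality strict.\<close>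
    obtain i0 where i0: "\<bar>v \<bullet> n i\<bar> \<le> \<bar>v \<bullet> n i0\<bar>" for i
    proof -
      have "finite (range (\<lambda>i. \<bar>v \<bullet> n i\<bar>))" "range (\<lambda>i. \<bar>v \<bullet> n i\<bar>) \<noteq> {}"
        by auto
      from Max_in[OF this] obtain i0 where "Max (range (\<lambda>i. \<bar>v \<bullet> n i\<bar>)) = \<bar>v \<bullet> n i0\<bar>"
        by (elim rangeE)
      with Max_ge[OF \<open>finite (range (\<lambda>i. \<bar>v \<bullet> n i\<bar>))\<close>] show ?thesis
        by (intro that[of i0]) (metis rangeI)
    qed
    have "\<bar>v $ k\<bar> * c \<le> \<bar>v $ k\<bar> * \<bar>det ?N\<bar>"
      using c by (intro mult_left_mono) auto
    also have "\<dots> = \<bar>det ?M\<bar>"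
      by (simp only: cramer_lemma abs_mult)
    \<comment> \<open>After transposition the replaced column is a row and carries the small bound;
      the other rows consist of components of unit vectors, bounded by 1.\<close>
    also have "\<dots> = \<bar>det (transpose ?M)\<bar>"
      by (simp only: det_transpose)
    also have "\<dots> \<le> fact CARD('n) * (\<Prod>j\<in>UNIV. if j = k then \<bar>v \<bullet> n i0\<bar> else 1)"
    proof (rule det_bound_rows)
      fix j i
      have "\<bar>n i $ j\<bar> \<le> 1"
        using component_le_norm_cart[of "n i" j] n by simp
      then show "\<bar>transpose ?M $ j $ i\<bar> \<le> (if j = k then \<bar>v \<bullet> n i0\<bar> else 1)"
        using i0[of i] by (simp add: transpose_def Nv)
    qed
    also have "(\<Prod>j\<in>UNIV. if j = k then \<bar>v \<bullet> n i0\<bar> else 1) = \<bar>v \<bullet> n i0\<bar>"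
      by simp
    also have "fact CARD('n) * \<bar>v \<bullet> n i0\<bar> < fact CARD('n) * \<epsilon>"
      using lt[of i0] by (intro mult_strict_left_mono) auto
    also have "\<dots> = norm v * c / CARD('n)"
      by (simp add: \<epsilon>_def)
    finally show ?thesis .
  qed
  have "norm v * c \<le> (\<Sum>k\<in>UNIV. \<bar>v $ k\<bar>) * c"
    using c norm_le_l1_cart[of v] by (intro mult_right_mono) auto
  also have "\<dots> = (\<Sum>k\<in>UNIV. \<bar>v $ k\<bar> * c)"
    by (rule sum_distrib_right)
  also have "\<dots> < (\<Sum>k\<in>(UNIV :: 'n set). norm v * c / CARD('n))"
    using comp by (intro sum_strict_mono) auto
  also have "\<dots> = norm v * c"
    by simp
  finally show False by simp
qed

text \<open>\<open>n i\<close> is the normalized part of \<open>w i\<close> orthogonal to the span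
  of the other vectors, which is nonzero by independence: the direction of the dual basis
  vector.\<close>

lemma unit_normals_exist:
  fixes w :: "'n::finite \<Rightarrow> real^'n"
  assumes w: "inj w" "independent (range w)"
  shows "\<exists>n. (\<forall>i. norm (n i) = 1 \<and> 0 < n i \<bullet> w i \<and> (\<forall>j. j \<noteq> i \<longrightarrow> n i \<bullet> w j = 0))"
proof -
  have "\<exists>n. norm n = 1 \<and> 0 < n \<bullet> w i \<and> (\<forall>j. j \<noteq> i \<longrightarrow> n \<bullet> w j = 0)" for i
  proof -
    let ?D = "w ` (UNIV - {i})"
    obtain y z where y: "y \<in> span ?D" and z: "\<And>x. x \<in> span ?D \<Longrightarrow> orthogonal z x" and yz: "w i = y + z"
      using orthogonal_subspace_decomp_exists by blast
    have D: "range w - {w i} = ?D"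
      using w(1) by (auto simp: inj_def)
    have "w i \<notin> span ?D"
      using w(2) D unfolding dependent_def by (metis rangeI)
    then have "z \<noteq> 0"
      using y yz by auto
    have "z \<bullet> w i = z \<bullet> z"
      using z[OF y] by (simp add: yz inner_add_right orthogonal_def)
    moreover have "z \<bullet> w j = 0" if "j \<noteq> i" for j
      using z[OF span_base[of "w j" ?D]] that by (simp add: orthogonal_def)
    ultimately show ?thesis
      using \<open>z \<noteq> 0\<close> by (intro exI[of _ "z /\<^sub>R norm z"]) auto
  qed
  then show ?thesis
    by (intro choice allI)
qed

lemma enumeration_exists:
  assumes "card W = CARD('n::finite)" "finite W"
  shows "\<exists>w :: 'n \<Rightarrow> 'a. inj w \<and> range w = W"
  using finite_same_card_bij[of "UNIV :: 'n set" W] assms by (auto simp: bij_betw_def)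

text \<open>The \<open>d\<close>-sine is the absolute determinant of the unit normals, so these are
  wide. Tested on \<open>w i\<close>, to which all normals but \<open>n i\<close> are orthogonal,
  this bounds each height below by \<open>c' * norm (w i)\<close>. In the expansion of
  \<open>u\<close> in the normals, the product with \<open>w i\<close> isolates the
  \<open>i\<close>-th coordinate; small products would make all coordinates, and so
  \<open>u\<close>, too small. This last sum costs the second factor \<open>1 / d\<close>.\<close>

lemma wide_frame_of_d_sine:
  fixes W :: "(real^'n) set"
  assumes W: "card W = CARD('n)" and c: "c > 0" "d_sine W \<ge> c"
  shows "wide_frame (c / (real CARD('n) ^ 2 * fact CARD('n))) W"
proof -
  \<comment> \<open>A dependent set has \<open>d\<close>-sine 0 by definition, below
    \<open>c\<close>.\<close>
  have ind: "independent W"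
    using c by (auto simp: d_sine_def split: if_splits)
  obtain w :: "'n \<Rightarrow> real^'n" where w: "inj w" "range w = W"
    using enumeration_exists[OF W independent_imp_finite[OF ind]] by blast
  have ind': "independent (range w)"
    using ind w(2) by simp
  obtain n where n: "\<And>i. norm (n i) = 1" "\<And>i. 0 < n i \<bullet> w i" "\<And>i j. j \<noteq> i \<Longrightarrow> n i \<bullet> w j = 0"
    using unit_normals_exist[OF w(1) ind'] by blast
  have det_w: "det (\<chi> i. w i) \<noteq> 0"
    by (rule independent_family_basis(2)[OF w(1) ind'])
  have "d_sine W = (\<Prod>i\<in>UNIV. n i \<bullet> w i) / \<bar>det (\<chi> i. w i)\<bar>"
    using d_sine_eq_prod_heights[OF w(1) ind' n(1) n(3) n(2)] w(2) by simp
  also have "\<dots> = \<bar>(\<Prod>i\<in>UNIV. n i \<bullet> w i)\<bar> / \<bar>det (\<chi> i. w i)\<bar>"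
    using n(2) by (simp add: prod_pos less_imp_le)
  also have "\<dots> = \<bar>det (\<chi> i. n i)\<bar>"
  proof -
    have "(\<Prod>i\<in>UNIV. n i \<bullet> w i) = det (\<chi> i. n i) * det (\<chi> i. w i)"
      by (rule prod_heights_eq_det_normals) (rule n(3))
    then show ?thesis
      using det_w by (simp only: abs_mult nonzero_mult_div_cancel_right abs_eq_0 not_False_eq_True)
  qed
  finally have det_n: "c \<le> \<bar>det (\<chi> i. n i)\<bar>"
    using c(2) by simp
  define c' where "c' = c / (CARD('n) * fact CARD('n))"
  have c': "c' > 0"
    using c(1) by (simp add: c'_def)
  have normals: "\<exists>i. c' * norm v \<le> \<bar>v \<bullet> n i\<bar>" for v
    unfolding c'_def by (rule wide_rows_of_det[OF n(1) c(1) det_n])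
  have w0: "w i \<noteq> 0" for i
    using n(2)[of i] by auto
  have height: "c' * norm (w i) \<le> n i \<bullet> w i" for i
  proof -
    obtain j where j: "c' * norm (w i) \<le> \<bar>w i \<bullet> n j\<bar>"
      using normals by blast
    have "0 < c' * norm (w i)"
      using c' w0 by simp
    then have "n j \<bullet> w i \<noteq> 0"
      using j by (auto simp: inner_commute)
    then have "j = i"
      using n(3)[of i j] by auto
    then show ?thesis
      using j n(2)[of i] by (simp add: inner_commute)
  qed
  have "inj (row_comb n)"
    using det_n c(1) det_nz_iff_inj[OF linear_row_comb[of n]] by (auto simp: det_matrix_row_comb)
  then have surj: "surj (row_comb n)"
    using linear_injective_imp_surjective[OF linear_row_comb[of n]] by simp
  show ?thesis
    unfolding wide_frame_def
  proof (rule allI, rule ccontr)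
    fix u
    assume "\<not> (\<exists>x\<in>W. c / (real CARD('n) ^ 2 * fact CARD('n)) * norm u * norm x \<le> \<bar>u \<bullet> x\<bar>)"
    moreover have "c / (real CARD('n) ^ 2 * fact CARD('n)) = c' / CARD('n)"
      by (simp add: c'_def power2_eq_square)
    ultimately have lt: "\<bar>u \<bullet> w i\<bar> < c' / CARD('n) * norm u * norm (w i)" for i
      using w(2) by (auto simp: not_le)
    obtain x where x: "u = row_comb n x"
      using surj by (metis surjD)
    have small: "\<bar>x $ i\<bar> < norm u / CARD('n)" for i
    proof -
      have "u \<bullet> w i = (\<Sum>j\<in>UNIV. x $ j * (n j \<bullet> w i))"
        by (simp add: x row_comb_def inner_sum_left)
      also have "\<dots> = (\<Sum>j\<in>UNIV. if j = i then x $ j * (n j \<bullet> w i) else 0)"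
        using n(3) by (intro sum.cong) auto
      finally have "u \<bullet> w i = x $ i * (n i \<bullet> w i)"
        by simp
      then have "\<bar>x $ i\<bar> * (n i \<bullet> w i) = \<bar>u \<bullet> w i\<bar>"
        using n(2)[of i] by (simp add: abs_mult)
      also have "\<dots> < norm u / CARD('n) * (c' * norm (w i))"
        using lt[of i] by (simp add: mult_ac)
      also have "\<dots> \<le> norm u / CARD('n) * (n i \<bullet> w i)"
        using height[of i] by (intro mult_left_mono) auto
      finally show ?thesis
        by (simp only: mult_less_cancel_right_pos[OF n(2)])
    qed
    have "norm u \<le> (\<Sum>i\<in>UNIV. norm (x $ i *\<^sub>R n i))"
      unfolding x row_comb_def by (rule norm_sum)
    also have "\<dots> = (\<Sum>i\<in>UNIV. \<bar>x $ i\<bar>)"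
      by (simp add: n(1))
    also have "\<dots> < (\<Sum>i\<in>(UNIV :: 'n set). norm u / CARD('n))"
      using small by (intro sum_strict_mono) auto
    also have "\<dots> = norm u"
      by simp
    finally show False by simp
  qed
qed

text \<open>Wideness in the direction \<open>n i\<close> can be witnessed only by
  \<open>w i\<close>, the other vectors being orthogonal to it; hence each height is at least
  \<open>m * norm (w i)\<close>. The determinant in the denominator is at most \<open>d!\<close>
  times the product of the norms, so lengths cancel.\<close>

lemma d_sine_of_wide_frame:
  fixes W :: "(real^'n) set"
  assumes W: "card W = CARD('n)" "independent W" and m: "m > 0" "wide_frame m W"
  shows "m ^ CARD('n) / fact CARD('n) \<le> d_sine W"
proof -
  obtain w :: "'n \<Rightarrow> real^'n" where w: "inj w" "range w = W"
    using enumeration_exists[OF W(1) independent_imp_finite[OF W(2)]] by blast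
  have ind': "independent (range w)"
    using W(2) w(2) by simp
  obtain n where n: "\<And>i. norm (n i) = 1" "\<And>i. 0 < n i \<bullet> w i" "\<And>i j. j \<noteq> i \<Longrightarrow> n i \<bullet> w j = 0"
    using unit_normals_exist[OF w(1) ind'] by blast
  have w0: "w i \<noteq> 0" for i
    using n(2)[of i] by auto
  define P where "P = (\<Prod>i\<in>UNIV. norm (w i))"
  have P: "P > 0"
    using w0 by (simp add: P_def prod_pos)
  have height: "m * norm (w i) \<le> n i \<bullet> w i" for i
  proof -
    obtain j where j: "m * norm (w j) \<le> \<bar>n i \<bullet> w j\<bar>"
      using m(2) w(2) n(1)[of i] unfolding wide_frame_def by (metis mult.right_neutral rangeE)
    have "0 < m * norm (w j)"
      using m(1) w0 by simp
    then have "n i \<bullet> w j \<noteq> 0"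
      using j by auto
    then have "j = i"
      using n(3) by blast
    then show ?thesis
      using j n(2)[of i] by simp
  qed
  have det_w: "\<bar>det (\<chi> i. w i)\<bar> > 0"
    using independent_family_basis(2)[OF w(1) ind'] by simp
  have "\<bar>det (\<chi> i. w i)\<bar> \<le> fact CARD('n) * P"
    unfolding P_def by (rule det_bound_rows) (simp add: component_le_norm_cart)
  then have "m ^ CARD('n) / fact CARD('n) \<le> m ^ CARD('n) * P / \<bar>det (\<chi> i. w i)\<bar>"
    using det_w m(1) by (simp add: field_simps)
  also have "m ^ CARD('n) * P = (\<Prod>i\<in>UNIV. m * norm (w i))"
    by (simp add: P_def prod.distrib)
  also have "\<dots> / \<bar>det (\<chi> i. w i)\<bar> \<le> (\<Prod>i\<in>UNIV. n i \<bullet> w i) / \<bar>det (\<chi> i. w i)\<bar>"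
    using height m(1) by (intro divide_right_mono prod_mono) auto
  also have "\<dots> = d_sine W"
    using d_sine_eq_prod_heights[OF w(1) ind' n(1) n(3) n(2)] w(2) by simp
  finally show ?thesis .
qed

lemma generalized_maximum_angle_condition_iff_uniformly_wide:
  fixes \<F> :: "(real^'n) set set set"
  assumes simplices: "\<And>T S. T \<in> \<F> \<Longrightarrow> S \<in> T \<Longrightarrow> int DIM(real^'n) simplex S"
  shows "generalized_maximum_angle_condition \<F> \<longleftrightarrow> uniformly_wide \<F>"
proof
  assume "generalized_maximum_angle_condition \<F>"
  then obtain c where c: "c > 0" and choice: "\<forall>T\<in>\<F>. \<forall>S\<in>T. \<exists>W \<subseteq> edge_vectors S. card W = DIM(real^'n) \<and> d_sine W \<ge> c"
    unfolding generalized_maximum_angle_condition_def by (elim exE conjE)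
  define m where "m = c / (real CARD('n) ^ 2 * fact CARD('n))"
  have "wide_frame m (edge_vectors S)" if TS: "T \<in> \<F>" "S \<in> T" for T S
  proof -
    obtain W where W: "W \<subseteq> edge_vectors S" "card W = DIM(real^'n)" "d_sine W \<ge> c"
      using bspec[OF bspec[OF choice TS(1)] TS(2)] by (elim exE conjE)
    then have "wide_frame m W"
      unfolding m_def by (intro wide_frame_of_d_sine c) auto
    with W(1) show ?thesis
      unfolding wide_frame_def by blast
  qed
  moreover have "m > 0"
    using c by (simp add: m_def)
  ultimately show "uniformly_wide \<F>"
    unfolding uniformly_wide_def by blast
next
  assume wide: "uniformly_wide \<F>"
  have "\<exists>m>0. \<forall>T\<in>\<F>. \<forall>S\<in>T.
      \<exists>W\<subseteq>edge_vectors S. card W = DIM(real^'n) \<and> independent W \<and> wide_frame m W"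
    by (rule uniformly_wide_choice) (fact simplices, fact wide)
  then obtain m where m: "m > 0" and choice: "\<forall>T\<in>\<F>. \<forall>S\<in>T.
      \<exists>W\<subseteq>edge_vectors S. card W = DIM(real^'n) \<and> independent W \<and> wide_frame m W"
    by (elim exE conjE)
  have "\<exists>W\<subseteq>edge_vectors S. card W = DIM(real^'n) \<and> m ^ CARD('n) / fact CARD('n) \<le> d_sine W"
    if TS: "T \<in> \<F>" "S \<in> T" for T S
  proof -
    obtain W where W: "W \<subseteq> edge_vectors S" "card W = DIM(real^'n)" "independent W" "wide_frame m W"
      using bspec[OF bspec[OF choice TS(1)] TS(2)] by (elim exE conjE)
    then have "m ^ CARD('n) / fact CARD('n) \<le> d_sine W"
      by (intro d_sine_of_wide_frame m) auto
    with W(1,2) show ?thesis by blast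
  qed
  moreover have "m ^ CARD('n) / fact CARD('n) > 0"
    using m by simp
  ultimately show "generalized_maximum_angle_condition \<F>"
    unfolding generalized_maximum_angle_condition_def by blast
qed

theorem theorem3p10:
  fixes P :: "(real ^ 'n) set" and \<F> :: "(real ^ 'n) set set set"
  assumes "CARD('n) \<ge> 2"
    and "polytopal_body P"
    and "face_to_face_family P \<F>"
  shows "(jamet_condition \<F> \<longleftrightarrow> generalized_maximum_angle_condition \<F>) \<and>
         (jamet_condition \<F> \<longleftrightarrow> maximum_angle_condition \<F>)"
proof -
  have simplices: "int DIM(real^'n) simplex S" if "T \<in> \<F>" "S \<in> T" for T S
    using assms(3) that unfolding face_to_face_family_def face_to_face_partition_def by blast
  have "jamet_condition \<F> \<longleftrightarrow> uniformly_wide \<F>"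
    using jamet_condition_imp_uniformly_wide[of \<F>] uniformly_wide_imp_jamet_condition[of \<F>] simplices by blast
  moreover have "maximum_angle_condition \<F> \<longleftrightarrow> uniformly_wide \<F>"
    using maximum_angle_condition_imp_uniformly_wide[of \<F>] uniformly_wide_imp_maximum_angle_condition[of \<F>]
      simplices by blast
  moreover have "generalized_maximum_angle_condition \<F> \<longleftrightarrow> uniformly_wide \<F>"
    using generalized_maximum_angle_condition_iff_uniformly_wide[of \<F>] simplices by blast
  ultimately show ?thesis by blast
qed

end
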